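(* Let $\ell\ge 1$ and let $F$ be a graph with a color-critical edge such that $M_\ell$ does not contain $F$; let $k$ denote the chromatic number of $F$. Then there exists $n_0$ such that for every $n\ge n_0$, \[\mathrm{ex}(n,M_\ell,F)=\mathcal{N}(M_\ell,T_{k-1}(n)),\] i.e. $M_\ell$ is $F$-Tur\'an-good.
   Context: $M_\ell$ denotes the matching with $\ell$ edges ($2\ell$ vertices). For graphs $H,G$, $\mathcal{N}(H,G)$ is the number of subgraphs of $G$ isomorphic to $H$, and $\mathrm{ex}(n,H,F)$ is the maximum of $\mathcal{N}(H,G)$ over $F$-free graphs $G$ on $n$ vertices. $T_r(n)$ is the complete $r$-partite graph on $n$ vertices with all parts of size $\lfloor n/r\rfloor$ or $\lceil n/r\rceil$. An edge of $F$ is color-critical if deleting it decreases the chromatic number of $F$. For a $k$-chromatic $F$ and a graph $H$ not containing $F$, $H$ is $F$-Tur\'an-good if $\mathrm{ex}(n,H,F)=\mathcal{N}(H,T_{k-1}(n))$ for all $n$ large enough. *)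

theory Defs
  imports Main
begin

type_synonym 'a sgraph = "'a set \<times> 'a set set"

definition sgraph :: "'a sgraph \<Rightarrow> bool" where
  "sgraph G \<longleftrightarrow> finite (fst G) \<and> (\<forall>e\<in>snd G. e \<subseteq> fst G \<and> card e = 2)"

definition graph_iso :: "'a sgraph \<Rightarrow> 'b sgraph \<Rightarrow> bool" where
  "graph_iso G H \<longleftrightarrow> (\<exists>f. bij_betw f (fst G) (fst H) \<and> snd H = (\<lambda>e. f ` e) ` snd G)"

definition subgraphs :: "'a sgraph \<Rightarrow> 'a sgraph set" where
  "subgraphs G = {S. fst S \<subseteq> fst G \<and> snd S \<subseteq> snd G \<and> (\<forall>e\<in>snd S. e \<subseteq> fst S)}"

definition count_sub :: "'b sgraph \<Rightarrow> 'a sgraph \<Rightarrow> nat" where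
  "count_sub H G = card {S \<in> subgraphs G. graph_iso S H}"

definition contains :: "'a sgraph \<Rightarrow> 'b sgraph \<Rightarrow> bool" where
  "contains G F \<longleftrightarrow> (\<exists>S\<in>subgraphs G. graph_iso S F)"

definition ex_gen :: "nat \<Rightarrow> 'b sgraph \<Rightarrow> 'c sgraph \<Rightarrow> nat" where
  "ex_gen n H F = Max {count_sub H G | G :: nat sgraph. sgraph G \<and> fst G = {0..<n} \<and> \<not> contains G F}"

definition proper_colouring :: "'a sgraph \<Rightarrow> nat \<Rightarrow> ('a \<Rightarrow> nat) \<Rightarrow> bool" where
  "proper_colouring G k c \<longleftrightarrow> (\<forall>v\<in>fst G. c v < k) \<and>
     (\<forall>e\<in>snd G. \<forall>u\<in>e. \<forall>v\<in>e. u \<noteq> v \<longrightarrow> c u \<noteq> c v)"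

definition chi :: "'a sgraph \<Rightarrow> nat" where
  "chi G = (LEAST k. \<exists>c. proper_colouring G k c)"

definition color_critical_edge :: "'a sgraph \<Rightarrow> 'a set \<Rightarrow> bool" where
  "color_critical_edge F e \<longleftrightarrow> e \<in> snd F \<and> chi (fst F, snd F - {e}) < chi F"

definition turan :: "nat \<Rightarrow> nat \<Rightarrow> nat sgraph" where
  "turan r n = ({0..<n}, {{i, j} | i j. i < n \<and> j < n \<and> i mod r \<noteq> j mod r})"

definition matching :: "nat \<Rightarrow> nat sgraph" where
  "matching l = ({0..<2*l}, {{2*i, 2*i+1} | i. i < l})"

end

theory Submission
  imports Defs Complex_Main "HOL-Library.FuncSet"
begin

text \<open>
  Put \<open>r = chi F - 1\<close> and \<open>t = card (fst F)\<close>.  Deleting the critical edge makes \<open>F\<close> \<open>r\<close>-colourable with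
  both ends of that edge in one class, so an \<open>F\<close>-free graph contains no complete \<open>r\<close>-partite graph with
  parts of size \<open>t\<close> and one extra edge inside a part.  A large graph of this kind whose minimum degree is
  at least \<open>(1 - 1/r - \<gamma>) n\<close> is \<open>r\<close>-colourable, and among \<open>r\<close>-colourable graphs the
  Turan graph has the most \<open>l\<close>-matchings, because moving a vertex from a large colour class to a
  small one never destroys matchings.

  The minimum degree condition is removed by progressive induction on the number of vertices.  If a
  vertex has smaller degree, the number of \<open>l\<close>-matchings through it is at least one less than the increment
  of the number of \<open>l\<close>-matchings of the Turan graph; here the induction hypothesis for \<open>l - 1\<close> bounds the
  contribution of each incident edge.  Every such deletion therefore raises the excess over the Turan
  graph by at least one, while the excess of a graph of bounded size is bounded.
\<close>

section \<open>Matchings\<close>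

text \<open>The degree condition is removed by comparing orders of magnitude. A deficit of
  \<open>\<gamma> * n\<close> edges at one vertex costs of the order of
  \<open>\<gamma> * n ^ (2 * l - 1)\<close> matchings of size \<open>l\<close>, whereas shifting the
  number of vertices by a constant causes errors of order \<open>n ^ (2 * l - 2)\<close> only; the
  deficit therefore wins by much more than the single unit that the induction spends. This rests on
  a lower bound of the right order for the Turan count, available for \<open>r \<ge> 2\<close>; for
  \<open>r = 1\<close> the threshold is not positive and no vertex lies below it.

  The colouring comes from a skeleton. Large minimum degree forces a complete
  \<open>r\<close>-partite subgraph with parts of constant size. Almost every vertex sees nothing of
  one part and most of every other part, which sorts almost all vertices into \<open>r\<close>
  independent classes. These classes are so large and so densely joined that every vertex, sorted or
  not, must avoid one of them entirely, and the avoided class serves as its colour. Each violation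
  on the way produces the forbidden configuration. The value of \<open>\<gamma>\<close> keeps all
  losses small enough for \<open>t\<close> vertices per class to be picked greedily.\<close>

definition matchings :: "nat \<Rightarrow> 'a set set \<Rightarrow> 'a set set set" where
  "matchings l E = {M. M \<subseteq> E \<and> card M = l \<and> pairwise disjnt M}"

definition mnum :: "nat \<Rightarrow> 'a set set \<Rightarrow> nat" where
  "mnum l E = card (matchings l E)"

definition del :: "'a set set \<Rightarrow> 'a set \<Rightarrow> 'a set set" where
  "del E X = {e \<in> E. e \<inter> X = {}}"

definition nbh :: "'a set set \<Rightarrow> 'a \<Rightarrow> 'a set" where
  "nbh E v = {u. {u, v} \<in> E}"

lemma finite_matchings: "finite E \<Longrightarrow> finite (matchings l E)"
  by (rule finite_subset[of _ "Pow E"]) (auto simp: matchings_def)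

lemma del_subset: "del E X \<subseteq> E"
  by (auto simp: del_def)

lemma mnum_0: "finite E \<Longrightarrow> mnum 0 E = 1"
proof -
  assume "finite E"
  then have "matchings 0 E = {{}}"
    by (auto simp: matchings_def pairwise_def dest: finite_subset)
  then show ?thesis by (simp add: mnum_def)
qed

lemma mnum_le_power:
  assumes "finite E"
  shows "mnum l E \<le> card E ^ l"
proof -
  have "mnum l E \<le> card {M. M \<subseteq> E \<and> card M = l}"
    unfolding mnum_def matchings_def by (intro card_mono) (use assms in auto)
  also have "\<dots> = card E choose l"
    using n_subsets[OF assms] by simp
  also have "\<dots> \<le> card E ^ l"
    by (cases "l \<le> card E") (simp_all add: binomial_le_pow binomial_eq_0)
  finally show ?thesis .
qed

lemma mnum_image_le:
  assumes inj: "inj_on h (\<Union>E)" and sub: "(\<lambda>e. h ` e) ` E \<subseteq> E'" and fin: "finite E'"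
  shows "mnum l E \<le> mnum l E'"
proof -
  have injE: "inj_on ((`) h) E"
    using inj by (meson Sup_upper inj_on_image_eq_iff inj_onI)
  have "inj_on (\<lambda>M. (`) h ` M) (matchings l E)"
  proof (rule inj_onI)
    fix M N assume "M \<in> matchings l E" "N \<in> matchings l E" "(`) h ` M = (`) h ` N"
    then show "M = N"
      using inj_on_image_eq_iff[OF injE] by (auto simp: matchings_def)
  qed
  moreover have "(\<lambda>M. (`) h ` M) ` matchings l E \<subseteq> matchings l E'"
  proof
    fix N assume "N \<in> (\<lambda>M. (`) h ` M) ` matchings l E"
    then obtain M where M: "M \<subseteq> E" "card M = l" "pairwise disjnt M" "N = (`) h ` M"
      by (auto simp: matchings_def)
    have "card N = l"
      using M inj_on_subset[OF injE M(1)] by (simp add: card_image)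
    moreover have "pairwise disjnt N"
    proof (rule pairwiseI)
      fix x y assume "x \<in> N" "y \<in> N" "x \<noteq> y"
      then obtain e e' where e: "e \<in> M" "e' \<in> M" "x = h ` e" "y = h ` e'" "e \<noteq> e'"
        using M by auto
      then have "e \<inter> e' = {}"
        using M(3) by (auto simp: pairwise_def disjnt_def)
      moreover have "h ` (e \<inter> e') = h ` e \<inter> h ` e'"
        using inj_on_image_Int[OF inj, of e e'] e M(1) by blast
      ultimately show "disjnt x y"
        using e by (auto simp: disjnt_def)
    qed
    ultimately show "N \<in> matchings l E'"
      using M sub by (auto simp: matchings_def)
  qed
  ultimately show ?thesis
    unfolding mnum_def by (metis card_inj_on_le finite_matchings[OF fin])
qed

lemma mnum_mono: "E \<subseteq> E' \<Longrightarrow> finite E' \<Longrightarrow> mnum l E \<le> mnum l E'"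
  by (rule mnum_image_le[of id]) auto

text \<open>A matching either avoids \<open>x\<close> or uses exactly one edge
  \<open>{x, y}\<close>, whose removal leaves a matching avoiding both ends. This recursion drives
  the moving argument for multipartite graphs and, with \<open>x\<close> a vertex of low degree, the
  induction on the number of vertices.\<close>

lemma mnum_rec:
  assumes fin: "finite E" and two: "\<forall>e\<in>E. card e = 2"
  shows "mnum (Suc l) E = mnum (Suc l) (del E {x}) + (\<Sum>y\<in>nbh E x. mnum l (del E {x, y}))"
proof -
  let ?J = "\<lambda>y. insert {x, y} ` matchings l (del E {x, y})"
  have finM: "finite M" if "M \<in> matchings m E'" "E' \<subseteq> E" for M m E'
    using that by (intro finite_subset[OF _ fin, of M]) (auto simp: matchings_def)
  have E_pair: "\<exists>y. e = {x, y} \<and> y \<noteq> x" if "e \<in> E" "x \<in> e" for e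
  proof -
    have "card e = 2" using that two by blast
    then obtain a b where "e = {a, b}" "a \<noteq> b" by (auto simp: card_2_iff)
    then show ?thesis using that(2) by blast
  qed
  have notin: "{x, y} \<notin> M" if "M \<in> matchings l (del E {x, y})" for M y
    using that by (auto simp: matchings_def del_def)
  have fin_nbh: "finite (nbh E x)"
  proof -
    have "nbh E x \<subseteq> \<Union>E" by (auto simp: nbh_def)
    moreover have "finite (\<Union>E)"
      using fin two by (intro finite_Union) (auto intro: card_ge_0_finite)
    ultimately show ?thesis by (rule finite_subset)
  qed
  have eq: "matchings (Suc l) E = matchings (Suc l) (del E {x}) \<union> (\<Union>y\<in>nbh E x. ?J y)"
  proof (intro equalityI subsetI)
    fix M assume M: "M \<in> matchings (Suc l) E"
    show "M \<in> matchings (Suc l) (del E {x}) \<union> (\<Union>y\<in>nbh E x. ?J y)"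
    proof (cases "x \<in> \<Union>M")
      case False
      then show ?thesis using M by (auto simp: matchings_def del_def)
    next
      case True
      then obtain e where e: "e \<in> M" "x \<in> e" by auto
      then have "e \<in> E" using M by (auto simp: matchings_def)
      then obtain y where y: "e = {x, y}" "y \<noteq> x" using E_pair e by blast
      have "M - {e} \<in> matchings l (del E {x, y})"
      proof -
        have "card (M - {e}) = l"
          using M e finM[OF M order_refl] by (simp add: matchings_def)
        moreover have "e' \<inter> {x, y} = {}" if "e' \<in> M - {e}" for e'
        proof -
          have "pairwise disjnt M" "e' \<in> M" "e' \<noteq> e"
            using M that by (auto simp: matchings_def)
          then have "disjnt e' e" using e(1) by (simp add: pairwise_def)
          then show ?thesis using y by (simp add: disjnt_def)
        qed
        moreover have "pairwise disjnt (M - {e})"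
          using M by (auto simp: matchings_def pairwise_def)
        ultimately show ?thesis using M by (auto simp: matchings_def del_def)
      qed
      moreover have "M = insert {x, y} (M - {e})" using e y by auto
      moreover have "y \<in> nbh E x" using y \<open>e \<in> E\<close> by (simp add: nbh_def insert_commute)
      ultimately show ?thesis by blast
    qed
  next
    fix M assume "M \<in> matchings (Suc l) (del E {x}) \<union> (\<Union>y\<in>nbh E x. ?J y)"
    then consider "M \<in> matchings (Suc l) (del E {x})" | y where "y \<in> nbh E x" "M \<in> ?J y" by blast
    then show "M \<in> matchings (Suc l) E"
    proof cases
      case 1
      then show ?thesis by (auto simp: matchings_def del_def)
    next
      case 2
      then obtain N where N: "N \<in> matchings l (del E {x, y})" "M = insert {x, y} N" by auto
      have "card M = Suc l"
        using notin[OF N(1)] finM[OF N(1) del_subset] N by (simp add: matchings_def)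
      moreover have "{x, y} \<in> E" using 2(1) by (simp add: nbh_def insert_commute)
      moreover have "pairwise disjnt M"
        using N by (auto simp: matchings_def del_def pairwise_insert disjnt_def)
      ultimately show ?thesis using N by (auto simp: matchings_def del_def)
    qed
  qed
  have card_J: "card (?J y) = mnum l (del E {x, y})" for y
    unfolding mnum_def
  proof (rule card_image, rule inj_onI)
    fix M N assume "M \<in> matchings l (del E {x, y})" "N \<in> matchings l (del E {x, y})"
      "insert {x, y} M = insert {x, y} N"
    then show "M = N" using notin by (metis insert_ident)
  qed
  have finJ: "finite (?J y)" for y
    by (simp add: finite_matchings finite_subset[OF del_subset fin])
  have disjJ: "?J y \<inter> ?J z = {}" if "y \<noteq> z" for y z
  proof -
    have False if M: "M \<in> matchings l (del E {x, y})" and N: "N \<in> matchings l (del E {x, z})"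
      and eq: "insert {x, y} M = insert {x, z} N" for M N
    proof -
      have "{x, y} \<noteq> {x, z}" using \<open>y \<noteq> z\<close> by (auto simp: doubleton_eq_iff)
      then have "{x, y} \<in> N" using eq by blast
      then show False using N by (auto simp: matchings_def del_def)
    qed
    then show ?thesis by blast
  qed
  have "mnum (Suc l) E = card (matchings (Suc l) (del E {x})) + card (\<Union>y\<in>nbh E x. ?J y)"
    unfolding mnum_def eq
  proof (rule card_Un_disjoint)
    show "finite (matchings (Suc l) (del E {x}))"
      by (simp add: finite_matchings finite_subset[OF del_subset fin])
    show "finite (\<Union>y\<in>nbh E x. ?J y)" using fin_nbh finJ by blast
    show "matchings (Suc l) (del E {x}) \<inter> (\<Union>y\<in>nbh E x. ?J y) = {}"
      by (auto simp: matchings_def del_def)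
  qed
  also have "card (\<Union>y\<in>nbh E x. ?J y) = (\<Sum>y\<in>nbh E x. card (?J y))"
    by (rule card_UN_disjoint) (use fin_nbh finJ disjJ in auto)
  finally show ?thesis by (simp add: card_J mnum_def[of "Suc l"])
qed

section \<open>Complete multipartite graphs\<close>

text \<open>Describing the parts by a colouring turns moving a vertex into a function update and
  deleting vertices into a change of \<open>V\<close> alone.\<close>

definition cmult :: "'a set \<Rightarrow> ('a \<Rightarrow> nat) \<Rightarrow> 'a set set" where
  "cmult V c = {{u, v} | u v. u \<in> V \<and> v \<in> V \<and> c u \<noteq> c v}"

lemma finite_cmult: "finite V \<Longrightarrow> finite (cmult V c)"
  by (rule finite_subset[of _ "Pow V"]) (auto simp: cmult_def)

lemma card_cmult_edge: "e \<in> cmult V c \<Longrightarrow> card e = 2"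
  by (auto simp: cmult_def card_2_iff)

lemma del_cmult: "del (cmult V c) X = cmult (V - X) c"
  by (auto simp: del_def cmult_def)

lemma nbh_cmult: "x \<in> V \<Longrightarrow> nbh (cmult V c) x = {y \<in> V. c y \<noteq> c x}"
  by (auto simp: nbh_def cmult_def doubleton_eq_iff)

lemma cmult_cong: "(\<And>v. v \<in> V \<Longrightarrow> c v = d v) \<Longrightarrow> cmult V c = cmult V d"
  unfolding cmult_def by (intro Collect_cong ex_cong1) auto

lemma mnum_cmult_embed:
  assumes "inj_on h V" "h ` V \<subseteq> W" "finite W"
    and "\<And>u v. u \<in> V \<Longrightarrow> v \<in> V \<Longrightarrow> c u \<noteq> c v \<Longrightarrow> d (h u) \<noteq> d (h v)"
  shows "mnum l (cmult V c) \<le> mnum l (cmult W d)"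
proof (rule mnum_image_le)
  show "inj_on h (\<Union>(cmult V c))"
    by (rule inj_on_subset[OF assms(1)]) (auto simp: cmult_def)
  show "(\<lambda>e. h ` e) ` cmult V c \<subseteq> cmult W d"
  proof
    fix e' assume "e' \<in> (\<lambda>e. h ` e) ` cmult V c"
    then obtain u v where uv: "u \<in> V" "v \<in> V" "c u \<noteq> c v" "e' = {h u, h v}"
      by (auto simp: cmult_def)
    then show "e' \<in> cmult W d"
      using assms(2,4) unfolding cmult_def by blast
  qed
qed (simp add: finite_cmult assms)

lemma mnum_cmult_rec:
  assumes "finite V" "x \<in> V"
  shows "mnum (Suc l) (cmult V c) = mnum (Suc l) (cmult (V - {x}) c)
    + (\<Sum>y\<in>{y \<in> V. c y \<noteq> c x}. mnum l (cmult (V - {x, y}) c))"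
  using mnum_rec[OF finite_cmult[OF assms(1), of c], of l x] assms(2)
  by (simp add: card_cmult_edge nbh_cmult del_cmult)

abbreviation cls :: "'a set \<Rightarrow> ('a \<Rightarrow> nat) \<Rightarrow> nat \<Rightarrow> 'a set" where
  "cls V c i \<equiv> {v \<in> V. c v = i}"

text \<open>Expand both counts at \<open>x\<close>. Deleting \<open>x\<close> leaves the same graph
  before and after the move, and neighbours outside classes \<open>a\<close> and \<open>b\<close>
  contribute equal terms. The move only trades the neighbours in class \<open>b\<close> for the rest
  of class \<open>a\<close>, which is at least as large. No traded term is larger than its
  replacement by the induction hypothesis: removing \<open>x\<close> from class \<open>a\<close> and
  \<open>y\<close> from class \<open>b\<close> preserves the gap of two.\<close>

lemma mnum_cmult_move:
  assumes "finite V" "x \<in> V" "c x = a" "card (cls V c b) + 2 \<le> card (cls V c a)"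
  shows "mnum l (cmult V c) \<le> mnum l (cmult V (c(x := b)))"
  using assms
proof (induction l arbitrary: V x)
  case 0
  then show ?case by (simp add: mnum_0 finite_cmult)
next
  case (Suc l)
  let ?c' = "c(x := b)"
  let ?A = "cls V c a" and ?B = "cls V c b" and ?R = "{y \<in> V. c y \<noteq> a \<and> c y \<noteq> b}"
  let ?m = "\<lambda>y. mnum l (cmult (V - {x, y}) c)"
  have ab: "a \<noteq> b" using Suc.prems by auto
  have fin: "finite ?A" "finite ?B" "finite ?R" using Suc.prems by auto
  have x: "x \<in> ?A" using Suc.prems by auto
  \<comment> \<open>Deleting \<open>x, y'\<close> leaves, up to renaming \<open>y\<close> as \<open>y'\<close>, the graph obtained from deleting \<open>x, y\<close> by moving \<open>y'\<close> to class \<open>b\<close>.\<close>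
  have le: "?m y \<le> ?m y'" if y: "y \<in> ?B" and y': "y' \<in> ?A - {x}" for y y'
  proof -
    let ?W = "V - {x, y}"
    have cls_eq: "cls ?W c b = ?B - {y}" "cls ?W c a = ?A - {x}"
      using y x ab by auto
    have card_W: "card (cls ?W c b) + 2 \<le> card (cls ?W c a)"
      unfolding cls_eq using Suc.prems(4) card_Suc_Diff1[OF fin(2) y] card_Suc_Diff1[OF fin(1) x] by linarith
    have "?m y \<le> mnum l (cmult ?W (c(y' := b)))"
      by (rule Suc.IH[OF _ _ _ card_W]) (use Suc.prems y y' ab in auto)
    also have "\<dots> \<le> ?m y'"
    proof (rule mnum_cmult_embed[where h = "\<lambda>v. if v = y' then y else v"])
      show "inj_on (\<lambda>v. if v = y' then y else v) ?W" by (auto simp: inj_on_def)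
      show "(\<lambda>v. if v = y' then y else v) ` ?W \<subseteq> V - {x, y'}"
        using y y' ab Suc.prems by auto
      show "finite (V - {x, y'})" using Suc.prems by simp
    qed (use y in auto)
    finally show ?thesis .
  qed
  have cardBA: "card ?B \<le> card (?A - {x})"
    using Suc.prems(4) x fin by simp
  then obtain h where h: "inj_on h ?B" "h ` ?B \<subseteq> ?A - {x}"
    using card_le_inj[of ?B "?A - {x}"] fin by auto
  have "(\<Sum>y\<in>?B. ?m y) \<le> (\<Sum>y\<in>?B. ?m (h y))"
    by (rule sum_mono, rule le) (use h in auto)
  also have "\<dots> = (\<Sum>y\<in>h ` ?B. ?m y)"
    by (simp add: sum.reindex[OF h(1)])
  also have "\<dots> \<le> (\<Sum>y\<in>?A - {x}. ?m y)"
    by (rule sum_mono2) (use h fin in auto)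
  finally have sums: "(\<Sum>y\<in>?B. ?m y) \<le> (\<Sum>y\<in>?A - {x}. ?m y)" .
  have c1: "{y \<in> V. c y \<noteq> c x} = ?B \<union> ?R" "?B \<inter> ?R = {}" using Suc.prems ab by auto
  have c2: "{y \<in> V. ?c' y \<noteq> ?c' x} = (?A - {x}) \<union> ?R" "(?A - {x}) \<inter> ?R = {}"
    using Suc.prems ab by auto
  have cong1: "cmult (V - {x, y}) ?c' = cmult (V - {x, y}) c" for y
    by (rule cmult_cong) auto
  have cong2: "cmult (V - {x}) ?c' = cmult (V - {x}) c"
    by (rule cmult_cong) auto
  have "mnum (Suc l) (cmult V c) = mnum (Suc l) (cmult (V - {x}) c) + ((\<Sum>y\<in>?B. ?m y) + (\<Sum>y\<in>?R. ?m y))"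
    using mnum_cmult_rec[OF Suc.prems(1,2), of l c] sum.union_disjoint[OF fin(2,3) c1(2), of ?m]
    by (simp only: c1(1))
  moreover have "mnum (Suc l) (cmult V ?c') = mnum (Suc l) (cmult (V - {x}) c)
      + ((\<Sum>y\<in>?A - {x}. ?m y) + (\<Sum>y\<in>?R. ?m y))"
    using mnum_cmult_rec[OF Suc.prems(1,2), of l ?c'] sum.union_disjoint[OF _ fin(3) c2(2), of ?m] fin(1)
    by (simp only: c2(1) cong1 cong2 finite_Diff)
  ultimately show ?case using sums by linarith
qed

section \<open>Balanced partitions and the Turan graph\<close>

lemma balanced_sizes:
  fixes s :: "nat \<Rightarrow> nat"
  assumes "r > 0" and bal: "\<And>a b. a < r \<Longrightarrow> b < r \<Longrightarrow> s a \<le> s b + 1"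
    and n: "n = (\<Sum>i<r. s i)"
  shows "\<forall>i<r. s i = n div r \<or> s i = n div r + 1" "card {i. i < r \<and> s i = n div r + 1} = n mod r"
proof -
  define m where "m = Min (s ` {..<r})"
  have "m \<in> s ` {..<r}" unfolding m_def by (rule Min_in) (use assms in auto)
  then obtain b where b: "b < r" "s b = m" by auto
  have m_le: "m \<le> s i" if "i < r" for i unfolding m_def using that by simp
  have cases: "s i = m \<or> s i = m + 1" if "i < r" for i
    using m_le[OF that] bal[OF that b(1)] b(2) by linarith
  let ?L = "{i. i < r \<and> s i = m + 1}"
  have "n = (\<Sum>i<r. m + (if s i = m + 1 then 1 else 0))"
    unfolding n by (rule sum.cong) (use cases in force)+
  also have "\<dots> = r * m + (\<Sum>i\<in>{..<r} \<inter> {i. s i = m + 1}. 1)"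
    by (simp add: sum.distrib sum.If_cases)
  also have "{..<r} \<inter> {i. s i = m + 1} = ?L" by auto
  finally have n_eq: "n = r * m + card ?L" by simp
  \<comment> \<open>A class of minimal size lies outside \<open>?L\<close>, so
    \<open>card ?L < r\<close>, and the equation for \<open>n\<close> is a division with
    remainder.\<close>
  have "b \<notin> ?L" using b by simp
  then have "?L \<subset> {..<r}" using b(1) by blast
  then have "card ?L < card {..<r}" by (intro psubset_card_mono) auto
  then have L: "card ?L < r" by simp
  have "n div r = m" using n_eq L by simp
  moreover have "n mod r = card ?L" using n_eq L by simp
  ultimately show "\<forall>i<r. s i = n div r \<or> s i = n div r + 1" "card {i. i < r \<and> s i = n div r + 1} = n mod r"
    using cases by auto
qed

lemma card_eq_sum_cls:
  assumes "finite V" "\<forall>v\<in>V. c v < r"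
  shows "card V = (\<Sum>i<r. card (cls V c i))"
proof -
  have "card V = card (\<Union>i\<in>{..<r}. cls V c i)"
    by (rule arg_cong[where f = card]) (use assms in auto)
  also have "\<dots> = (\<Sum>i<r. card (cls V c i))"
    by (rule card_UN_disjoint) (use assms in auto)
  finally show ?thesis .
qed

text \<open>The number of vertices and the number of classes determine the sizes of a balanced
  partition, so the two graphs agree up to a permutation of the colours. The roles of the two graphs
  are symmetric, so one direction is enough.\<close>

lemma mnum_cmult_balanced_le:
  assumes fin: "finite V" "finite W" "card V = card W" and r: "r > 0"
    and c: "\<forall>v\<in>V. c v < r" and d: "\<forall>w\<in>W. d w < r"
    and balc: "\<And>a b. a < r \<Longrightarrow> b < r \<Longrightarrow> card (cls V c a) \<le> card (cls V c b) + 1"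
    and bald: "\<And>a b. a < r \<Longrightarrow> b < r \<Longrightarrow> card (cls W d a) \<le> card (cls W d b) + 1"
  shows "mnum l (cmult V c) \<le> mnum l (cmult W d)"
proof -
  let ?n = "card V"
  let ?s = "\<lambda>i. card (cls V c i)" and ?t = "\<lambda>i. card (cls W d i)"
  define q where "q = ?n div r"
  note bs = balanced_sizes[OF r balc card_eq_sum_cls[OF fin(1) c], folded q_def]
  note bt = balanced_sizes[OF r bald card_eq_sum_cls[OF fin(2) d], folded fin(3), folded q_def]
  let ?L = "{i. i < r \<and> ?s i = q + 1}" and ?K = "{i. i < r \<and> ?t i = q + 1}"
  have "card ({..<r} - ?L) = card ({..<r} - ?K)"
    using bs(2) bt(2) by (subst (1 2) card_Diff_subset) auto
  then obtain f2 where f2: "bij_betw f2 ({..<r} - ?L) ({..<r} - ?K)"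
    using finite_same_card_bij[of "{..<r} - ?L" "{..<r} - ?K"] by auto
  obtain f1 where f1: "bij_betw f1 ?L ?K"
    using finite_same_card_bij[of ?L ?K] bs(2) bt(2) by auto
  \<comment> \<open>A permutation of the colours that sends large classes to large ones and small
    classes to small ones.\<close>
  define p where "p i = (if i \<in> ?L then f1 i else f2 i)" for i
  have "bij_betw p ?L ?K"
    using f1 by (subst bij_betw_cong[of _ _ f1]) (auto simp: p_def)
  moreover have "bij_betw p ({..<r} - ?L) ({..<r} - ?K)"
    using f2 by (subst bij_betw_cong[of _ _ f2]) (auto simp: p_def)
  ultimately have "bij_betw p (?L \<union> ({..<r} - ?L)) (?K \<union> ({..<r} - ?K))"
    by (rule bij_betw_combine) auto
  moreover have "?L \<union> ({..<r} - ?L) = {..<r}" "?K \<union> ({..<r} - ?K) = {..<r}" by auto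
  ultimately have p: "bij_betw p {..<r} {..<r}" by simp
  have size: "?s i = ?t (p i)" if i: "i < r" for i
  proof (cases "i \<in> ?L")
    case True
    then have "p i \<in> ?K" using f1 by (auto simp: p_def dest: bij_betwE)
    then show ?thesis using True by simp
  next
    case False
    then have "p i \<in> {..<r} - ?K" using f2 i unfolding p_def by (auto dest: bij_betwE)
    then show ?thesis using False bs(1) bt(1) i by auto
  qed
  have "\<forall>i. \<exists>g. i < r \<longrightarrow> bij_betw g (cls V c i) (cls W d (p i))"
    using size finite_same_card_bij[of "cls V c _" "cls W d (p _)"] fin by simp
  then obtain g where g: "\<And>i. i < r \<Longrightarrow> bij_betw (g i) (cls V c i) (cls W d (p i))"
    by metis
  define h where "h v = g (c v) v" for v
  have h: "h v \<in> W" "d (h v) = p (c v)" if "v \<in> V" for v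
    using bij_betwE[OF g[of "c v"]] c that by (auto simp: h_def)
  have p_inj: "p (c u) = p (c v) \<Longrightarrow> c u = c v" if "u \<in> V" "v \<in> V" for u v
    using p c that by (auto simp: bij_betw_def inj_on_def)
  show ?thesis
  proof (rule mnum_cmult_embed[where h = h])
    show "inj_on h V"
    proof (rule inj_onI)
      fix u v assume uv: "u \<in> V" "v \<in> V" "h u = h v"
      then have cc: "c u = c v" using h p_inj by metis
      have "inj_on (g (c u)) (cls V c (c u))" using g c uv by (auto simp: bij_betw_def)
      then show "u = v" using uv cc by (auto simp: h_def inj_on_def)
    qed
    show "h ` V \<subseteq> W" using h by auto
    show "finite W" by fact
    show "d (h u) \<noteq> d (h v)" if "u \<in> V" "v \<in> V" "c u \<noteq> c v" for u v
      using h p_inj that by metis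
  qed
qed

text \<open>Apart from \<open>a\<close> itself, every member of the residue class of
  \<open>a\<close> is at least \<open>a + r\<close>. Shifting these down by one period and across to
  residue \<open>b\<close> is injective; the omitted element accounts for the
  \<open>+ 1\<close>.\<close>

lemma mod_classes_balanced:
  assumes "a < r" "b < r"
  shows "card (cls {0..<n} (\<lambda>i. i mod r) a) \<le> card (cls {0..<n} (\<lambda>i. i mod r) b) + 1"
proof -
  let ?A = "cls {0..<n} (\<lambda>i. i mod r) a" and ?B = "cls {0..<n} (\<lambda>i. i mod r) b"
  let ?f = "\<lambda>v. v - a - r + b"
  have ge: "a + r \<le> v" if "v \<in> ?A - {a}" for v
  proof -
    have v: "v = r * (v div r) + a" "v \<noteq> a" using that mult_div_mod_eq[of r v] by auto
    then have "v div r \<ge> 1" by (cases "v div r") auto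
    then have "r * 1 \<le> r * (v div r)" by (intro mult_le_mono) auto
    then show ?thesis using v by linarith
  qed
  have "card (?A - {a}) \<le> card ?B"
  proof (rule card_inj_on_le[where f = ?f])
    show "inj_on ?f (?A - {a})"
    proof (rule inj_onI)
      fix x y assume "x \<in> ?A - {a}" "y \<in> ?A - {a}" "?f x = ?f y"
      with ge[of x] ge[of y] show "x = y" by linarith
    qed
    show "?f ` (?A - {a}) \<subseteq> ?B"
    proof
      fix w assume "w \<in> ?f ` (?A - {a})"
      then obtain v where v: "v \<in> ?A - {a}" "w = ?f v" by auto
      have g: "a + r \<le> v" by (rule ge) fact
      have veq: "v = r * (v div r) + a" using v mult_div_mod_eq[of r v] by auto
      define k where "k = v div r"
      have k: "v = r * k + a" using veq by (simp add: k_def)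
      then have "k \<ge> 1" using g assms by (cases k) auto
      then obtain k' where "k = Suc k'" by (cases k) auto
      then have "w = r * k' + b" using v(2) k by simp
      then have "w mod r = b" using assms by simp
      moreover have "w < n" using v g assms by auto
      ultimately show "w \<in> ?B" by simp
    qed
    show "finite ?B" by simp
  qed
  moreover have "card ?A \<le> card (?A - {a}) + 1"
    using card_Diff_singleton_if[of ?A a] by auto
  ultimately show ?thesis by linarith
qed

definition tnum :: "nat \<Rightarrow> nat \<Rightarrow> nat \<Rightarrow> nat" where
  "tnum r l n = mnum l (snd (turan r n))"

lemma turan_eq_cmult: "snd (turan r n) = cmult {0..<n} (\<lambda>i. i mod r)"
  by (auto simp: turan_def cmult_def)

text \<open>While two class sizes differ by at least two, a move does not lower the count but
  strictly lowers the sum of squared class sizes. The process stops at a balanced partition, which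
  is the Turan graph up to renaming.\<close>

lemma mnum_cmult_le_tnum:
  assumes "finite V" and r: "r > 0" and "\<forall>v\<in>V. c v < r"
  shows "mnum l (cmult V c) \<le> tnum r l (card V)"
  using assms(3)
proof (induction "\<Sum>i<r. (card (cls V c i))\<^sup>2" arbitrary: c rule: less_induct)
  case less
  let ?s = "\<lambda>c i. card (cls V c i)"
  show ?case
  proof (cases "\<exists>a<r. \<exists>b<r. ?s c b + 2 \<le> ?s c a")
    case True
    then obtain a b where ab: "a < r" "b < r" "?s c b + 2 \<le> ?s c a" by auto
    then have neq: "a \<noteq> b" by auto
    have "cls V c a \<noteq> {}" using ab(3) by (intro notI) (simp only: card.empty)
    then obtain x where x: "x \<in> V" "c x = a" by auto
    let ?c' = "c(x := b)"
    have ca: "cls V ?c' a = cls V c a - {x}" and cb: "cls V ?c' b = insert x (cls V c b)"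
      using x neq by auto
    have sa: "?s c a = Suc (?s ?c' a)"
      unfolding ca by (rule card.remove) (use x assms(1) in auto)
    have sb: "?s ?c' b = Suc (?s c b)"
      unfolding cb by (rule card_insert_disjoint) (use x neq assms(1) in auto)
    have so: "?s ?c' i = ?s c i" if "i \<noteq> a" "i \<noteq> b" for i
      by (rule arg_cong[where f = card]) (use that x in auto)
    have split: "(\<Sum>i<r. (?s d i)\<^sup>2) = (?s d a)\<^sup>2 + (?s d b)\<^sup>2 + (\<Sum>i\<in>{..<r} - {a} - {b}. (?s d i)\<^sup>2)" for d
      using ab neq by (simp add: sum.remove[of "{..<r}" a] sum.remove[of "{..<r} - {a}" b])
    have "(\<Sum>i\<in>{..<r} - {a} - {b}. (?s ?c' i)\<^sup>2) = (\<Sum>i\<in>{..<r} - {a} - {b}. (?s c i)\<^sup>2)"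
      using so by (intro sum.cong) auto
    moreover have "(?s ?c' a)\<^sup>2 + (?s ?c' b)\<^sup>2 < (?s c a)\<^sup>2 + (?s c b)\<^sup>2"
      using ab(3) unfolding sa sb by (simp add: power2_eq_square)
    ultimately have "(\<Sum>i<r. (?s ?c' i)\<^sup>2) < (\<Sum>i<r. (?s c i)\<^sup>2)"
      unfolding split[of c] split[of ?c'] by linarith
    then have "mnum l (cmult V ?c') \<le> tnum r l (card V)"
      by (rule less.hyps) (use less.prems ab in auto)
    then show ?thesis
      using mnum_cmult_move[of V x c a b l, OF assms(1) x ab(3)] by linarith
  next
    case False
    have bal: "?s c a \<le> ?s c b + 1" if "a < r" "b < r" for a b
    proof (rule ccontr)
      assume "\<not> ?s c a \<le> ?s c b + 1"
      then have "?s c b + 2 \<le> ?s c a" by linarith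
      then show False using False that by blast
    qed
    show ?thesis
      unfolding tnum_def turan_eq_cmult
      by (rule mnum_cmult_balanced_le[OF assms(1) _ _ r less.prems _ bal mod_classes_balanced])
        (use r in auto)
  qed
qed

section \<open>Graphs of high minimum degree\<close>

lemma sgraph_edge:
  assumes "sgraph (V, E)" "{u, v} \<in> E"
  shows "u \<in> V" "v \<in> V" "u \<noteq> v"
proof -
  have "{u, v} \<subseteq> V" "card {u, v} = 2" using assms by (auto simp: sgraph_def)
  then show "u \<in> V" "v \<in> V" "u \<noteq> v" by auto
qed

lemma sgraph_finite:
  assumes "sgraph (V, E)"
  shows "finite V" "finite E"
proof -
  show "finite V" using assms by (simp add: sgraph_def)
  moreover have "E \<subseteq> Pow V" using assms by (auto simp: sgraph_def)
  ultimately show "finite E" by (meson finite_Pow_iff finite_subset)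
qed

lemma nbh_sym: "u \<in> nbh E v \<longleftrightarrow> v \<in> nbh E u"
  by (simp add: nbh_def insert_commute)

lemma nbh_subset: "sgraph (V, E) \<Longrightarrow> nbh E v \<subseteq> V"
  using sgraph_edge by (auto simp: nbh_def)

section \<open>Complete multipartite subgraphs forced by large degrees\<close>

definition joined :: "'a set set \<Rightarrow> (nat \<Rightarrow> 'a set) \<Rightarrow> nat \<Rightarrow> bool" where
  "joined E P r \<longleftrightarrow> (\<forall>i<r. \<forall>j<r. i \<noteq> j \<longrightarrow> (\<forall>x\<in>P i. \<forall>y\<in>P j. {x, y} \<in> E))"

text \<open>The configuration that forces a copy of \<open>F\<close>. Disjointness of the parts is
  left implicit: in a simple graph a vertex common to two joined parts would carry a loop.\<close>

definition kplus :: "nat \<Rightarrow> nat \<Rightarrow> 'a set \<Rightarrow> 'a set set \<Rightarrow> bool" where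
  "kplus r t V E \<longleftrightarrow> (\<exists>P i u v. i < r \<and> joined E P r \<and> (\<forall>j<r. P j \<subseteq> V \<and> card (P j) = t)
     \<and> u \<in> P i \<and> v \<in> P i \<and> {u, v} \<in> E)"

lemma joined_mono:
  "joined E P r \<Longrightarrow> (\<And>i. i < r \<Longrightarrow> Q i \<subseteq> P i) \<Longrightarrow> joined E Q r"
  unfolding joined_def by blast

lemma sum_nbh_Int:
  assumes G: "sgraph (V, E)" and X: "X \<subseteq> V"
  shows "(\<Sum>v\<in>V. card (nbh E v \<inter> X)) = (\<Sum>x\<in>X. card (nbh E x))"
proof -
  note fin = sgraph_finite[OF G]
  have finX: "finite X" using X fin finite_subset by blast
  have "(\<Sum>v\<in>V. card (nbh E v \<inter> X)) = (\<Sum>v\<in>V. \<Sum>x\<in>X. if x \<in> nbh E v then 1 else 0)"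
    using finX by (intro sum.cong) (simp_all add: sum.If_cases Int_def conj_commute)
  also have "\<dots> = (\<Sum>x\<in>X. \<Sum>v\<in>V. if x \<in> nbh E v then 1 else 0)"
    by (rule sum.swap)
  also have "\<dots> = (\<Sum>x\<in>X. card (nbh E x))"
  proof (rule sum.cong)
    fix x
    have "V \<inter> {v. x \<in> nbh E v} = nbh E x"
      using nbh_subset[OF G, of x] nbh_sym by fast
    then show "(\<Sum>v\<in>V. if x \<in> nbh E v then 1 else 0) = card (nbh E x)"
      using fin by (simp add: sum.If_cases)
  qed simp
  finally show ?thesis .
qed

lemma sum_joined_degrees:
  assumes G: "sgraph (V, E)" and B: "\<forall>i<j. B i \<subseteq> V \<and> card (B i) = T"
    and deg: "\<forall>v\<in>V. d \<le> real (card (nbh E v))"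
  shows "real j * real T * d \<le> real (\<Sum>v\<in>V. \<Sum>i<j. card (nbh E v \<inter> B i))"
proof -
  have "real j * real T * d = (\<Sum>i<j. \<Sum>x\<in>B i. d)"
    using B by simp
  also have "\<dots> \<le> (\<Sum>i<j. \<Sum>x\<in>B i. real (card (nbh E x)))"
    using B deg by (intro sum_mono) blast
  also have "\<dots> = (\<Sum>i<j. real (\<Sum>v\<in>V. card (nbh E v \<inter> B i)))"
    using B sum_nbh_Int[OF G] by (intro sum.cong) (simp_all flip: of_nat_sum)
  also have "\<dots> = real (\<Sum>v\<in>V. \<Sum>i<j. card (nbh E v \<inter> B i))"
    by (simp flip: of_nat_sum) (rule sum.swap)
  finally show ?thesis .
qed

lemma subset_of_card:
  assumes "t \<le> card S" "t > 0 \<or> finite S"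
  shows "\<exists>Q. Q \<subseteq> S \<and> card Q = t \<and> finite Q"
  using obtain_subset_with_card_n[OF assms(1)] by metis

text \<open>A step in the style of Erdos and Stone. Counting edges into the given parts shows that a
  positive proportion of the vertices is good, that is, has at least \<open>T\<close> neighbours in
  each part. For so many vertices the choice of \<open>T\<close> neighbours per part must coincide
  on \<open>T\<close> of them, and these form the new part.\<close>

lemma complete_multipartite_step:
  fixes d :: real
  assumes G: "sgraph (V, E)" and r: "1 \<le> j" "j < r" and T: "T \<ge> 1"
    and B: "\<forall>i<j. B i \<subseteq> V \<and> card (B i) = 4 * r * T" and joined: "joined E B j"
    and deg: "\<forall>v\<in>V. d \<le> real (card (nbh E v))"
    and d: "d \<ge> (1 - 1 / r - 1 / (2 * (real r)\<^sup>2)) * card V"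
    and n: "card V \<ge> 4 * r * r * T * 2 ^ (4 * r * T * j)"
  shows "\<exists>B'. (\<forall>i<Suc j. B' i \<subseteq> V \<and> card (B' i) = T) \<and> joined E B' (Suc j)"
proof -
  note fin = sgraph_finite[OF G]
  let ?n = "real (card V)"
  let ?M = "4 * r * T"
  define Good where "Good = {v \<in> V. \<forall>i<j. T \<le> card (nbh E v \<inter> B i)}"
  have finB: "finite (B i)" if "i < j" for i using B that fin finite_subset by blast
  have capM: "card (nbh E v \<inter> B i) \<le> ?M" if "i < j" for v i
    using card_mono[OF finB[OF that], of "nbh E v \<inter> B i"] B that by auto
  have good: "(\<Sum>i<j. card (nbh E v \<inter> B i)) \<le> j * ?M" for v
    using sum_mono[of "{..<j}" "\<lambda>i. card (nbh E v \<inter> B i)" "\<lambda>_. ?M"] capM by simp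
  have bad: "(\<Sum>i<j. card (nbh E v \<inter> B i)) \<le> (j - 1) * ?M + T" if "v \<in> V - Good" for v
  proof -
    have "\<exists>i<j. card (nbh E v \<inter> B i) < T" using that by (simp add: Good_def not_le)
    then obtain i where i: "i < j" "card (nbh E v \<inter> B i) < T" by blast
    have "(\<Sum>k\<in>{..<j} - {i}. card (nbh E v \<inter> B k)) \<le> (j - 1) * ?M"
      using sum_mono[of "{..<j} - {i}" "\<lambda>i. card (nbh E v \<inter> B i)" "\<lambda>_. ?M"] capM i by simp
    then show ?thesis using i by (simp add: sum.remove[of "{..<j}" i])
  qed
  have GV: "Good \<subseteq> V" and finG: "finite Good" using fin by (auto simp: Good_def)
  have "(\<Sum>v\<in>V. \<Sum>i<j. card (nbh E v \<inter> B i))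
      = (\<Sum>v\<in>Good. \<Sum>i<j. card (nbh E v \<inter> B i)) + (\<Sum>v\<in>V - Good. \<Sum>i<j. card (nbh E v \<inter> B i))"
    using sum.subset_diff[OF GV fin(1)] by (simp add: add.commute)
  also have "\<dots> \<le> (\<Sum>v\<in>Good. j * ?M) + (\<Sum>v\<in>V - Good. (j - 1) * ?M + T)"
    by (intro add_mono sum_mono good bad)
  also have "\<dots> \<le> card Good * (j * ?M) + card V * ((j - 1) * ?M + T)"
    using card_mono[OF fin(1), of "V - Good"] by (auto intro!: add_mono mult_le_mono)
  finally have up: "(\<Sum>v\<in>V. \<Sum>i<j. card (nbh E v \<inter> B i)) \<le> card Good * (j * ?M) + card V * ((j - 1) * ?M + T)" .
  have "real j * real ?M * d \<le> real (card Good * (j * ?M) + card V * ((j - 1) * ?M + T))"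
    using sum_joined_degrees[OF G B deg] of_nat_mono[OF up, where 'a = real] by linarith
  also have "\<dots> = card Good * (real j * real ?M) + ?n * ((real j - 1) * real ?M + T)"
    using r by (simp add: of_nat_diff)
  finally have main: "real j * real ?M * d \<le> card Good * (real j * real ?M) + ?n * ((real j - 1) * real ?M + T)" .
  have r0: "real r > 0" "real T > 0" using r T by auto
  \<comment> \<open>Here \<open>j \<le> r - 1\<close> enters. On average a vertex has at least
    \<open>(j - 1) * ?M + ?M / (2 * r)\<close> neighbours in the parts, counted with multiplicity.
    The factor \<open>4 * r\<close> in \<open>?M\<close> makes the surplus \<open>2 * T\<close>,
    while the surplus of a bad vertex is at most \<open>T\<close>.\<close>
  have "real j * (1 - 1 / r - 1 / (2 * (real r)\<^sup>2)) \<ge> real j - 1 + 1 / (2 * r)"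
  proof -
    have "real j * (1 / r + 1 / (2 * (real r)\<^sup>2)) \<le> (real r - 1) * (1 / r + 1 / (2 * (real r)\<^sup>2))"
      using r by (intro mult_right_mono) auto
    also have "\<dots> \<le> 1 - 1 / (2 * r)"
      using r0 by (simp add: field_simps power2_eq_square)
    finally show ?thesis by (simp add: algebra_simps)
  qed
  then have "real ?M * ?n * (real j - 1 + 1 / (2 * r)) \<le> real ?M * ?n * (real j * (1 - 1 / r - 1 / (2 * (real r)\<^sup>2)))"
    by (intro mult_left_mono) auto
  also have "\<dots> = real j * real ?M * ((1 - 1 / r - 1 / (2 * (real r)\<^sup>2)) * ?n)" by simp
  also have "\<dots> \<le> real j * real ?M * d" using d by (intro mult_left_mono) auto
  finally have "real ?M * ?n * (real j - 1 + 1 / (2 * r)) \<le> real j * real ?M * d" .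
  moreover have "real ?M * ?n * (real j - 1 + 1 / (2 * r)) = ?n * ((real j - 1) * real ?M) + 2 * T * ?n"
    using r0 by (simp add: field_simps)
  ultimately have "T * ?n \<le> card Good * (real j * real ?M)"
    using main distrib_left[of ?n "(real j - 1) * real ?M" "real T"] mult.commute[of ?n "real T"]
    by linarith
  also have "\<dots> \<le> card Good * (real r * real ?M)"
    using r by (intro mult_left_mono mult_right_mono) auto
  finally have "T * ?n \<le> T * (card Good * (4 * r * r))" by (simp add: algebra_simps)
  then have "?n \<le> card Good * (4 * r * r)" using r0 by simp
  then have gn: "card V \<le> card Good * (4 * r * r)"
    by (simp only: of_nat_le_iff)
  have "(4 * r * r) * (T * 2 ^ (?M * j)) = 4 * r * r * T * 2 ^ (?M * j)"
    by (rule mult.assoc[symmetric])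
  also have "\<dots> \<le> card V" by (rule n)
  also have "\<dots> \<le> card Good * (4 * r * r)" by (rule gn)
  also have "\<dots> = (4 * r * r) * card Good" by (rule mult.commute)
  finally have "(4 * r * r) * (T * 2 ^ (?M * j)) \<le> (4 * r * r) * card Good" .
  then have cG: "T * 2 ^ (?M * j) \<le> card Good" using r by simp
  have "\<exists>S. S \<subseteq> nbh E v \<inter> B i \<and> card S = T" if "v \<in> Good" "i < j" for v i
  proof -
    have "T \<le> card (nbh E v \<inter> B i)" using that by (simp add: Good_def)
    from subset_of_card[OF this] T show ?thesis by auto
  qed
  then obtain S where S: "\<And>v i. v \<in> Good \<Longrightarrow> i < j \<Longrightarrow> S v i \<subseteq> nbh E v \<inter> B i \<and> card (S v i) = T"
    by metis
  \<comment> \<open>Restriction makes the choice an element of a finite space of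
    \<open>2 ^ (?M * j)\<close> extensional functions, so that the pigeonhole principle
    applies.\<close>
  define f where "f v = restrict (S v) {..<j}" for v
  let ?Q = "\<Pi>\<^sub>E i\<in>{..<j}. Pow (B i)"
  have fQ: "f \<in> Good \<rightarrow> ?Q" using S by (auto simp: f_def)
  have "card ?Q = (\<Prod>i<j. card (Pow (B i)))" by (simp add: card_PiE)
  also have "\<dots> = (\<Prod>i<j. 2 ^ ?M)"
    using B finB by (intro prod.cong) (auto simp: card_Pow)
  also have "\<dots> = 2 ^ (?M * j)" by (simp add: power_mult)
  finally have cQ: "card ?Q = 2 ^ (?M * j)" .
  have "finite ?Q" using finB by (intro finite_PiE) auto
  moreover have "?Q \<noteq> {}" using cQ by (metis card.empty power_not_zero zero_neq_numeral)
  ultimately obtain y where y: "y \<in> ?Q" "card (f -` {y} \<inter> Good) * card ?Q \<ge> card Good"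
    using pigeonhole_card[OF fQ finG] by blast
  have "T * 2 ^ (?M * j) \<le> card (f -` {y} \<inter> Good) * 2 ^ (?M * j)"
    using order_trans[OF cG y(2)] by (simp only: cQ)
  then have "T \<le> card (f -` {y} \<inter> Good)" by (rule mult_right_le_imp_le) simp
  then obtain W where W: "W \<subseteq> f -` {y} \<inter> Good" "card W = T"
    using subset_of_card[of T "f -` {y} \<inter> Good"] T by auto
  then have "W \<noteq> {}" using T by auto
  then obtain w where w: "w \<in> W" by auto
  have yS: "y i = S v i" if "v \<in> W" "i < j" for v i
  proof -
    have "f v = y" using W that by auto
    then show ?thesis using that by (auto simp: f_def)
  qed
  have wG: "w \<in> Good" using w W by auto
  define B' where "B' = y(j := W)"
  have yB: "y i \<subseteq> B i" "card (y i) = T" if "i < j" for i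
    using S[OF wG that] yS[OF w that] by auto
  have Wy: "{x, z} \<in> E" if "x \<in> W" "i < j" "z \<in> y i" for x z i
  proof -
    have "x \<in> Good" using that W by auto
    then have "z \<in> nbh E x" using S[of x i] yS[of x i] that by auto
    then show ?thesis by (simp add: nbh_def insert_commute)
  qed
  have "\<forall>i<Suc j. B' i \<subseteq> V \<and> card (B' i) = T"
    using yB B W GV by (auto simp: B'_def less_Suc_eq) blast
  moreover have "joined E B' (Suc j)"
    unfolding joined_def
  proof (intro allI impI ballI)
    fix i k x z assume ik: "i < Suc j" "k < Suc j" "i \<noteq> k" "x \<in> B' i" "z \<in> B' k"
    then consider "i = j" "k < j" | "k = j" "i < j" | "i < j" "k < j" by linarith
    then show "{x, z} \<in> E"
    proof cases
      case 1 then show ?thesis using Wy[of x k z] ik by (auto simp: B'_def)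
    next
      case 2 then show ?thesis using Wy[of z i x] ik by (auto simp: B'_def insert_commute)
    next
      case 3 then show ?thesis using joined yB ik unfolding joined_def B'_def by (auto simp: subset_iff)
    qed
  qed
  ultimately show ?thesis by blast
qed

text \<open>Each new part shrinks the old ones by the factor \<open>4 * r\<close>, so the induction
  on \<open>j\<close> has to run over all sizes \<open>T\<close> at once.\<close>

lemma complete_multipartite_exists:
  fixes r j T :: nat
  assumes "1 \<le> j" "j \<le> r"
  shows "\<exists>n0. \<forall>(V :: 'a set) E. sgraph (V, E) \<and> n0 \<le> card V
      \<and> (\<forall>v\<in>V. (1 - 1 / r - 1 / (2 * (real r)\<^sup>2)) * real (card V) \<le> real (card (nbh E v)))
    \<longrightarrow> (\<exists>B. (\<forall>i<j. B i \<subseteq> V \<and> card (B i) = T) \<and> joined E B j)"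
  using assms
proof (induction j arbitrary: T rule: nat_induct_at_least)
  case base
  have "\<exists>B. (\<forall>i<1. B i \<subseteq> V \<and> card (B i) = T) \<and> joined E B 1"
    if G: "sgraph (V, E)" "T \<le> card V" for V :: "'a set" and E
  proof -
    obtain W where "W \<subseteq> V" "card W = T"
      using subset_of_card[OF G(2)] sgraph_finite[OF G(1)] by auto
    then show ?thesis by (intro exI[of _ "\<lambda>_. W"]) (simp add: joined_def)
  qed
  then show ?case by blast
next
  case (Suc j)
  show ?case
  proof (cases "T = 0")
    case True
    then show ?thesis by (intro exI[of _ 0] allI impI exI[of _ "\<lambda>_. {}"]) (simp add: joined_def)
  next
    case False
    obtain n0 where n0: "\<forall>(V :: 'a set) E. sgraph (V, E) \<and> n0 \<le> card V
        \<and> (\<forall>v\<in>V. (1 - 1 / r - 1 / (2 * (real r)\<^sup>2)) * real (card V) \<le> real (card (nbh E v)))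
      \<longrightarrow> (\<exists>B. (\<forall>i<j. B i \<subseteq> V \<and> card (B i) = 4 * r * T) \<and> joined E B j)"
      using Suc.IH[OF Suc_leD[OF Suc.prems], of "4 * r * T"] by (rule exE)
    show ?thesis
    proof (intro exI[of _ "max n0 (4 * r * r * T * 2 ^ (4 * r * T * j))"] allI impI, elim conjE)
      fix V :: "'a set" and E
      assume G: "sgraph (V, E)" and n: "max n0 (4 * r * r * T * 2 ^ (4 * r * T * j)) \<le> card V"
        and deg: "\<forall>v\<in>V. (1 - 1 / r - 1 / (2 * (real r)\<^sup>2)) * real (card V) \<le> real (card (nbh E v))"
      obtain B where B: "\<forall>i<j. B i \<subseteq> V \<and> card (B i) = 4 * r * T" "joined E B j"
        using n0[THEN spec, THEN spec, THEN mp, of V E] G deg n by auto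
      show "\<exists>B. (\<forall>i<Suc j. B i \<subseteq> V \<and> card (B i) = T) \<and> joined E B (Suc j)"
        by (rule complete_multipartite_step[OF G _ _ _ B deg order_refl])
          (use Suc.hyps Suc.prems False n in auto)
    qed
  qed
qed

section \<open>Criteria for the forbidden configuration\<close>

text \<open>The ends of the extra edge need not belong to the given parts. They are added to part
  \<open>i\<close>, which therefore has to supply only \<open>t - 2\<close> further vertices, and
  they fit there because all other parts lie in their common neighbourhood.\<close>

lemma kplusI:
  assumes G: "sgraph (V, E)" and i: "i < r" and uv: "{u, v} \<in> E" and t: "t \<ge> 2"
    and joined: "joined E P r" and PV: "\<forall>j<r. P j \<subseteq> V"
    and Pj: "\<forall>j<r. j \<noteq> i \<longrightarrow> t \<le> card (P j) \<and> P j \<subseteq> nbh E u \<inter> nbh E v"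
    and Pi: "P i \<inter> {u, v} = {}" "t \<le> card (P i) + 2"
  shows "kplus r t V E"
proof -
  note fin = sgraph_finite[OF G] and uvV = sgraph_edge[OF G uv]
  have "\<exists>Q. Q \<subseteq> P j \<and> card Q = (if j = i then t - 2 else t) \<and> finite Q" if "j < r" for j
  proof (rule subset_of_card)
    have "finite (P j)" using PV fin(1) that finite_subset by blast
    then show "0 < (if j = i then t - 2 else t) \<or> finite (P j)" by simp
    show "(if j = i then t - 2 else t) \<le> card (P j)" using that Pj Pi by auto
  qed
  then obtain Q where Q: "\<And>j. j < r \<Longrightarrow> Q j \<subseteq> P j \<and> card (Q j) = (if j = i then t - 2 else t) \<and> finite (Q j)"
    by metis
  define R where "R = Q(i := insert u (insert v (Q i)))"
  have "u \<notin> Q i" "v \<notin> Q i" using Q[OF i] Pi by auto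
  then have cR: "card (R i) = t" using Q[OF i] uvV t by (simp add: R_def)
  then have R: "\<forall>j<r. R j \<subseteq> V \<and> card (R j) = t"
  proof (intro allI impI)
    fix j assume j: "j < r"
    have "Q j \<subseteq> V" using Q[OF j] PV j by blast
    then show "R j \<subseteq> V \<and> card (R j) = t"
      using cR Q[OF j] uvV by (cases "j = i") (auto simp: R_def)
  qed
  have adj: "{u, y} \<in> E \<and> {v, y} \<in> E" if "j < r" "j \<noteq> i" "y \<in> P j" for j y
  proof -
    have "y \<in> nbh E u" "y \<in> nbh E v" using Pj that by blast+
    then show ?thesis by (simp add: nbh_def insert_commute)
  qed
  have "joined E R r"
    unfolding joined_def
  proof (intro allI impI ballI)
    fix j k x y assume jk: "j < r" "k < r" "j \<noteq> k" "x \<in> R j" "y \<in> R k"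
    have "x \<in> P j \<or> j = i \<and> x \<in> {u, v}" "y \<in> P k \<or> k = i \<and> y \<in> {u, v}"
      using jk(4,5) Q[OF jk(1)] Q[OF jk(2)] by (auto simp: R_def split: if_splits)
    then consider "x \<in> P j" "y \<in> P k" | "j = i" "x \<in> {u, v}" "y \<in> P k" | "k = i" "y \<in> {u, v}" "x \<in> P j"
      using jk(3) by blast
    then show "{x, y} \<in> E"
    proof cases
      case 1 then show ?thesis using joined jk by (auto simp: joined_def)
    next
      case 2 then show ?thesis using adj[of k y] jk by auto
    next
      case 3 then show ?thesis using adj[of j x] jk by (auto simp: insert_commute)
    qed
  qed
  then show ?thesis
    unfolding kplus_def using R uv i by (intro exI[of _ R] exI[of _ i] exI[of _ u] exI[of _ v]) (auto simp: R_def)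
qed

text \<open>Parts are chosen one after the other. At most \<open>r * t\<close> vertices are already
  chosen, and each excludes at most \<open>D\<close> candidates from the next set, so
  \<open>t\<close> candidates survive.\<close>

lemma joined_greedy:
  fixes D :: real
  assumes D: "D \<ge> 0" and fin: "\<forall>j<r. finite (X j)"
    and non: "\<forall>i<r. \<forall>j<r. i \<noteq> j \<longrightarrow> (\<forall>x\<in>X i. real (card (X j - nbh E x)) \<le> D)"
    and large: "\<forall>j<r. real r * real t * D + real t \<le> real (card (X j))"
  shows "\<exists>P. (\<forall>j<r. P j \<subseteq> X j \<and> card (P j) = t) \<and> joined E P r"
proof -
  have "m \<le> r \<Longrightarrow> \<exists>P. (\<forall>j<m. P j \<subseteq> X j \<and> card (P j) = t) \<and> joined E P m" for m
  proof (induction m)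
    case 0
    then show ?case by (simp add: joined_def)
  next
    case (Suc m)
    then obtain P where P: "\<forall>j<m. P j \<subseteq> X j \<and> card (P j) = t" "joined E P m" by auto
    define U where "U = (\<Union>j<m. \<Union>x\<in>P j. X m - nbh E x)"
    have finP: "finite (P j)" if "j < m" for j
      using P(1) fin that Suc.prems by (meson Suc_le_lessD finite_subset less_trans)
    have "card U \<le> (\<Sum>j<m. \<Sum>x\<in>P j. card (X m - nbh E x))"
      unfolding U_def using finP
      by (intro order_trans[OF card_UN_le] sum_mono card_UN_le) auto
    then have "real (card U) \<le> real (\<Sum>j<m. \<Sum>x\<in>P j. card (X m - nbh E x))"
      by (simp only: of_nat_le_iff)
    also have "\<dots> = (\<Sum>j<m. \<Sum>x\<in>P j. real (card (X m - nbh E x)))" by simp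
    also have "\<dots> \<le> (\<Sum>j<m. \<Sum>x\<in>P j. D)"
    proof (intro sum_mono)
      fix j x assume jx: "j \<in> {..<m}" "x \<in> P j"
      then have "j < r" "m < r" "j \<noteq> m" "x \<in> X j" using P(1) Suc.prems by auto
      then show "real (card (X m - nbh E x)) \<le> D" using non by blast
    qed
    also have "\<dots> = real m * real t * D" using P(1) by simp
    also have "\<dots> \<le> real r * real t * D" using Suc.prems D by (intro mult_right_mono) auto
    finally have U: "real (card U) \<le> real r * real t * D" .
    have Xm: "finite (X m)" "real r * real t * D + real t \<le> real (card (X m))"
      using fin large Suc.prems by auto
    have "card (X m) \<le> card U + card (X m - U)"
    proof -
      have "finite U" unfolding U_def using finP Xm(1) by auto
      from diff_card_le_card_Diff[OF this, of "X m"] show ?thesis by linarith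
    qed
    then have "t \<le> card (X m - U)" using U Xm(2) by linarith
    then obtain W where W: "W \<subseteq> X m - U" "card W = t"
      using subset_of_card[of t "X m - U"] Xm(1) by auto
    define P' where "P' = P(m := W)"
    have adj: "{x, y} \<in> E" if "j < m" "x \<in> P j" "y \<in> W" for j x y
    proof -
      have "y \<in> X m" "y \<notin> U" using W that by auto
      then have "y \<in> nbh E x" using that unfolding U_def by blast
      then show ?thesis by (simp add: nbh_def insert_commute)
    qed
    have "\<forall>j<Suc m. P' j \<subseteq> X j \<and> card (P' j) = t"
      using P(1) W by (auto simp: P'_def less_Suc_eq)
    moreover have "joined E P' (Suc m)"
      unfolding joined_def
    proof (intro allI impI ballI)
      fix j k x y assume jk: "j < Suc m" "k < Suc m" "j \<noteq> k" "x \<in> P' j" "y \<in> P' k"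
      then consider "j = m" "k < m" | "k = m" "j < m" | "j < m" "k < m" by linarith
      then show "{x, y} \<in> E"
      proof cases
        case 1 then show ?thesis using adj[of k y x] jk by (auto simp: P'_def insert_commute)
      next
        case 2 then show ?thesis using adj[of j x y] jk by (auto simp: P'_def)
      next
        case 3 then show ?thesis using P(2) jk by (auto simp: joined_def P'_def)
      qed
    qed
    ultimately show ?case by blast
  qed
  then show ?thesis by blast
qed

lemma kplus_greedy:
  fixes D :: real
  assumes G: "sgraph (V, E)" and i: "i < r" and uv: "{u, v} \<in> E" and t: "t \<ge> 2" and D: "D \<ge> 0"
    and XV: "\<forall>j<r. X j \<subseteq> V"
    and Xj: "\<forall>j<r. j \<noteq> i \<longrightarrow> X j \<subseteq> nbh E u \<inter> nbh E v" and Xi: "X i \<inter> {u, v} = {}"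
    and non: "\<forall>i<r. \<forall>j<r. i \<noteq> j \<longrightarrow> (\<forall>x\<in>X i. real (card (X j - nbh E x)) \<le> D)"
    and large: "\<forall>j<r. real r * real t * D + real t \<le> real (card (X j))"
  shows "kplus r t V E"
proof -
  have "\<forall>j<r. finite (X j)" using XV sgraph_finite[OF G] finite_subset by blast
  then obtain P where P: "\<forall>j<r. P j \<subseteq> X j \<and> card (P j) = t" "joined E P r"
    using joined_greedy[OF D _ non large] by blast
  show ?thesis
  proof (rule kplusI[OF G i uv t P(2)])
    show "\<forall>j<r. P j \<subseteq> V" using P(1) XV by (meson order_trans)
    show "\<forall>j<r. j \<noteq> i \<longrightarrow> t \<le> card (P j) \<and> P j \<subseteq> nbh E u \<inter> nbh E v"
    proof (intro allI impI)
      fix j assume "j < r" "j \<noteq> i"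
      then have "P j \<subseteq> X j" "card (P j) = t" "X j \<subseteq> nbh E u \<inter> nbh E v" using P(1) Xj by simp_all
      then show "t \<le> card (P j) \<and> P j \<subseteq> nbh E u \<inter> nbh E v" by blast
    qed
    have "P i \<subseteq> X i" using P(1) i by simp
    then show "P i \<inter> {u, v} = {}" using Xi by blast
    show "t \<le> card (P i) + 2" using P(1) i by simp
  qed
qed

section \<open>Independent classes and the colouring\<close>

lemma card_le_remove_pair: "card S \<le> card (S - {u, v}) + 2"
proof -
  have "card S - card {u, v} \<le> card (S - {u, v})"
    by (rule diff_card_le_card_Diff) simp
  moreover have "card {u, v} \<le> 2" by (simp add: card_insert_if)
  ultimately show ?thesis by linarith
qed

lemma sum_two_le:
  fixes f :: "nat \<Rightarrow> nat"
  assumes "i < r" "j < r" "i \<noteq> j" "\<And>k. k < r \<Longrightarrow> f k \<le> M" "f i + f j \<le> L"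
  shows "(\<Sum>k<r. f k) \<le> L + (r - 2) * M"
proof -
  have "(\<Sum>k\<in>{..<r} - {i} - {j}. f k) \<le> (r - 2) * M"
    using sum_mono[of "{..<r} - {i} - {j}" f "\<lambda>_. M"] assms by (simp add: numeral_2_eq_2)
  then show ?thesis
    using assms by (simp add: sum.remove[of "{..<r}" i] sum.remove[of "{..<r} - {i}" j])
qed

text \<open>Vertices are sorted by the skeleton part they avoid. Every vertex has at most
  \<open>(r - 1) * (4 * t)\<close> neighbours in the skeleton, and an unsorted one has at least
  \<open>t\<close> fewer. The degree condition bounds the total deficit by
  \<open>t * (4 * r * g)\<close>, so at most \<open>4 * r * g\<close> vertices remain
  unsorted.\<close>

lemma independent_classes:
  fixes r t :: nat and g :: real
  assumes G: "sgraph (V, E)" and r: "r \<ge> 1" and t: "t \<ge> 2" and free: "\<not> kplus r t V E"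
    and B: "\<forall>i<r. B i \<subseteq> V \<and> card (B i) = 4 * t" and joined: "joined E B r"
    and deg: "\<forall>v\<in>V. (1 - 1 / r) * real (card V) - g \<le> real (card (nbh E v))"
  shows "\<exists>A. (\<forall>i<r. A i \<subseteq> V \<and> (\<forall>u\<in>A i. \<forall>v\<in>A i. {u, v} \<notin> E))
    \<and> (\<forall>i<r. \<forall>j<r. i \<noteq> j \<longrightarrow> A i \<inter> A j = {})
    \<and> real (card V) - 4 * real r * g \<le> (\<Sum>i<r. real (card (A i)))"
proof -
  note fin = sgraph_finite[OF G]
  let ?N = "\<lambda>v j. card (nbh E v \<inter> B j)"
  let ?n = "real (card V)"
  \<comment> \<open>Two vertices that each see \<open>3 * t\<close> of the \<open>4 * t\<close>
    vertices of a part share at least \<open>2 * t\<close> of them, more than enough for the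
    criterion.\<close>
  define A where "A i = {v \<in> V. nbh E v \<inter> B i = {} \<and> (\<forall>j<r. j \<noteq> i \<longrightarrow> 3 * t \<le> ?N v j)}" for i
  have finB: "finite (B i)" if "i < r" for i using B that fin finite_subset by blast
  have capM: "?N v i \<le> 4 * t" if "i < r" for v i
    using card_mono[OF finB[OF that], of "nbh E v \<inter> B i"] B that by auto
  have BV: "\<forall>j<r. B j \<subseteq> V" using B by blast
  have indep: "{u, v} \<notin> E" if i: "i < r" and uv: "u \<in> A i" "v \<in> A i" for i u v
  proof
    assume e: "{u, v} \<in> E"
    define P where "P j = (if j = i then B i - {u, v} else nbh E u \<inter> nbh E v \<inter> B j)" for j
    have PB: "P j \<subseteq> B j" for j by (auto simp: P_def)
    have "kplus r t V E"
    proof (rule kplusI[OF G i e t joined_mono[OF joined PB]])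
      show "\<forall>j<r. P j \<subseteq> V" using PB BV by blast
      show "\<forall>j<r. j \<noteq> i \<longrightarrow> t \<le> card (P j) \<and> P j \<subseteq> nbh E u \<inter> nbh E v"
      proof (intro allI impI)
        fix j assume j: "j < r" "j \<noteq> i"
        let ?X = "nbh E u \<inter> B j" and ?Y = "nbh E v \<inter> B j"
        have "card ?X + card ?Y = card (?X \<union> ?Y) + card (?X \<inter> ?Y)"
          by (rule card_Un_Int) (use finB j in auto)
        moreover have "card (?X \<union> ?Y) \<le> 4 * t"
          using card_mono[OF finB[OF j(1)], of "?X \<union> ?Y"] B j by auto
        moreover have "3 * t \<le> card ?X" "3 * t \<le> card ?Y" using uv j by (auto simp: A_def)
        moreover have "?X \<inter> ?Y = P j" using j by (auto simp: P_def)
        ultimately have "t \<le> card (P j)" by simp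
        then show "t \<le> card (P j) \<and> P j \<subseteq> nbh E u \<inter> nbh E v" using j by (auto simp: P_def)
      qed
      show "P i \<inter> {u, v} = {}" by (simp add: P_def)
      show "t \<le> card (P i) + 2" using card_le_remove_pair[of "B i" u v] B i by (simp add: P_def)
    qed
    then show False using free by simp
  qed
  have disj: "A i \<inter> A j = {}" if "i < r" "j < r" "i \<noteq> j" for i j
  proof -
    have False if "v \<in> A i" "v \<in> A j" for v
    proof -
      have "3 * t \<le> ?N v j" "nbh E v \<inter> B j = {}" using that \<open>i < r\<close> \<open>j < r\<close> \<open>i \<noteq> j\<close> by (auto simp: A_def)
      then show False using t by simp
    qed
    then show ?thesis by blast
  qed
  define U where "U = (\<Union>i<r. A i)"
  have good: "(\<Sum>j<r. ?N v j) \<le> (r - 1) * (4 * t)" if vU: "v \<in> U" for v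
  proof -
    obtain i where i: "i < r" "v \<in> A i" using vU by (auto simp: U_def)
    have "(\<Sum>k\<in>{..<r} - {i}. ?N v k) \<le> (r - 1) * (4 * t)"
      using sum_mono[of "{..<r} - {i}" "?N v" "\<lambda>_. 4 * t"] capM i by simp
    moreover have "?N v i = 0" using i by (simp add: A_def)
    ultimately show ?thesis using i by (simp add: sum.remove[of "{..<r}" i])
  qed
  have bad: "(\<Sum>j<r. ?N v j) + t \<le> (r - 1) * (4 * t)" if v: "v \<in> V - U" for v
  proof -
    \<comment> \<open>Two parts with at most \<open>3 * t\<close> neighbours together leave at most
      \<open>3 * t + (r - 2) * (4 * t)\<close> in total, which is the claimed saving of
      \<open>t\<close>.\<close>
    have "\<exists>i<r. \<exists>j<r. i \<noteq> j \<and> ?N v i + ?N v j \<le> 3 * t"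
    proof (cases "\<exists>i<r. nbh E v \<inter> B i = {}")
      case True
      then obtain i where i: "i < r" "nbh E v \<inter> B i = {}" by auto
      then have "v \<notin> A i" using v by (auto simp: U_def)
      then obtain j where "j < r" "j \<noteq> i" "?N v j < 3 * t" using i v by (auto simp: A_def not_le)
      then show ?thesis using i by (intro exI[of _ i] conjI exI[of _ j]) auto
    next
      case nonempty: False
      show ?thesis
      proof (rule ccontr)
        assume neg: "\<not> ?thesis"
        \<comment> \<open>If every two parts contain more than \<open>3 * t\<close> neighbours
          together, at most one part contains fewer than \<open>t\<close>. Take \<open>i\<close> to
          be that part. A neighbour \<open>u\<close> of \<open>v\<close> in \<open>B i\<close> is
          joined to all other parts, so \<open>{u, v}\<close> becomes the extra edge.\<close>
        have "\<exists>i<r. \<forall>j<r. j \<noteq> i \<longrightarrow> t \<le> ?N v j"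
        proof (cases "\<exists>i<r. ?N v i < t")
          case True
          then obtain i where i: "i < r" "?N v i < t" by auto
          have "t \<le> ?N v j" if "j < r" "j \<noteq> i" for j
          proof (rule ccontr)
            assume "\<not> t \<le> ?N v j"
            then have "?N v i + ?N v j \<le> 3 * t" using i by linarith
            then show False using neg i that by blast
          qed
          then show ?thesis using i by blast
        next
          case False
          then have "\<forall>j<r. t \<le> ?N v j" by (meson not_less)
          then show ?thesis using r by (intro exI[of _ 0]) simp
        qed
        then obtain i where i: "i < r" "\<forall>j<r. j \<noteq> i \<longrightarrow> t \<le> ?N v j" by blast
        obtain u where u: "u \<in> nbh E v" "u \<in> B i" using nonempty i by blast
        then have e: "{u, v} \<in> E" by (simp add: nbh_def)
        define P where "P j = (if j = i then B i - {u, v} else nbh E v \<inter> B j)" for j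
        have PB: "P j \<subseteq> B j" for j by (auto simp: P_def)
        have "kplus r t V E"
        proof (rule kplusI[OF G i(1) e t joined_mono[OF joined PB]])
          show "\<forall>j<r. P j \<subseteq> V" using PB BV by blast
          have "B j \<subseteq> nbh E u" if "j < r" "j \<noteq> i" for j
            using joined u i that by (auto simp: joined_def nbh_def)
          then show "\<forall>j<r. j \<noteq> i \<longrightarrow> t \<le> card (P j) \<and> P j \<subseteq> nbh E u \<inter> nbh E v"
            using i by (auto simp: P_def)
          show "P i \<inter> {u, v} = {}" by (simp add: P_def)
          show "t \<le> card (P i) + 2" using card_le_remove_pair[of "B i" u v] B i by (simp add: P_def)
        qed
        then show False using free by simp
      qed
    qed
    then obtain i j where ij: "i < r" "j < r" "i \<noteq> j" "?N v i + ?N v j \<le> 3 * t" by blast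
    have "(\<Sum>j<r. ?N v j) \<le> 3 * t + (r - 2) * (4 * t)"
      by (rule sum_two_le[OF ij(1-3) capM ij(4)])
    moreover obtain r' where "r = Suc (Suc r')"
      using that[of "r - 2"] ij(1-3) by simp
    ultimately show ?thesis by simp
  qed
  have UV: "U \<subseteq> V" by (auto simp: U_def A_def)
  have finU: "finite U" using UV fin finite_subset by blast
  have "real r * real (4 * t) * ((1 - 1 / r) * ?n - g) \<le> real (\<Sum>v\<in>V. \<Sum>i<r. ?N v i)"
    by (rule sum_joined_degrees[OF G B deg])
  moreover have "(\<Sum>v\<in>V. \<Sum>i<r. ?N v i) + t * card (V - U) \<le> card V * ((r - 1) * (4 * t))"
  proof -
    have "(\<Sum>v\<in>V. \<Sum>i<r. ?N v i) + t * card (V - U)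
        = (\<Sum>v\<in>U. \<Sum>i<r. ?N v i) + (\<Sum>v\<in>V - U. (\<Sum>i<r. ?N v i) + t)"
      using sum.subset_diff[OF UV fin(1), of "\<lambda>v. \<Sum>i<r. ?N v i"] by (simp add: sum.distrib)
    also have "\<dots> \<le> (\<Sum>v\<in>U. (r - 1) * (4 * t)) + (\<Sum>v\<in>V - U. (r - 1) * (4 * t))"
      by (intro add_mono sum_mono good bad)
    also have "\<dots> = (\<Sum>v\<in>V. (r - 1) * (4 * t))"
      using sum.subset_diff[OF UV fin(1), of "\<lambda>v. (r - 1) * (4 * t)"] by simp
    finally show ?thesis by simp
  qed
  then have "real ((\<Sum>v\<in>V. \<Sum>i<r. ?N v i) + t * card (V - U)) \<le> real (card V * ((r - 1) * (4 * t)))"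
    by (simp only: of_nat_le_iff)
  then have "real (\<Sum>v\<in>V. \<Sum>i<r. ?N v i) + t * real (card (V - U)) \<le> ?n * ((real r - 1) * (4 * t))"
    using r by (simp only: of_nat_add of_nat_mult of_nat_diff of_nat_1 of_nat_numeral)
  ultimately have "real r * real (4 * t) * ((1 - 1 / r) * ?n - g) + t * real (card (V - U)) \<le> ?n * ((real r - 1) * (4 * t))"
    by linarith
  moreover have "real r * real (4 * t) * ((1 - 1 / r) * ?n - g) = ?n * ((real r - 1) * (4 * t)) - t * (4 * real r * g)"
    using r by (simp add: field_simps)
  ultimately have "t * real (card (V - U)) \<le> t * (4 * real r * g)" by linarith
  then have few: "real (card (V - U)) \<le> 4 * real r * g" using t by simp
  have "real (card V) = real (card U) + real (card (V - U))"
    using card_Diff_subset[OF finU UV] card_mono[OF fin(1) UV] by simp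
  moreover have "card U = (\<Sum>i<r. card (A i))"
    unfolding U_def by (rule card_UN_disjoint) (use fin disj in \<open>auto simp: A_def\<close>)
  ultimately have "?n - 4 * real r * g \<le> (\<Sum>i<r. real (card (A i)))" using few by simp
  then show ?thesis
    using indep disj by (intro exI[of _ A]) (auto simp: A_def)
qed


text \<open>All classes have size close to \<open>p = n / r\<close>, and a vertex avoiding one class
  is adjacent to nearly all of every other. If a vertex met every class, or if two adjacent vertices
  avoided the same class, the greedy criterion would yield the forbidden configuration. Colouring
  each vertex by a class it avoids is therefore proper.\<close>

lemma colourable_of_independent_classes:
  fixes r t :: nat and g :: real
  assumes G: "sgraph (V, E)" and r: "r \<ge> 1" and t: "t \<ge> 2" and free: "\<not> kplus r t V E"
    and A: "\<And>i. i < r \<Longrightarrow> A i \<subseteq> V"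
    and indep: "\<And>i u v. i < r \<Longrightarrow> u \<in> A i \<Longrightarrow> v \<in> A i \<Longrightarrow> {u, v} \<notin> E"
    and disj: "\<And>i j. i < r \<Longrightarrow> j < r \<Longrightarrow> i \<noteq> j \<Longrightarrow> A i \<inter> A j = {}"
    and total: "real (card V) - 4 * real r * g \<le> (\<Sum>i<r. real (card (A i)))"
    and deg: "\<And>v. v \<in> V \<Longrightarrow> (1 - 1 / r) * real (card V) - g \<le> real (card (nbh E v))"
    and g: "g \<ge> 0" "100 * real r ^ 3 * real t * g \<le> real (card V)"
    and n: "10 * real r * real t \<le> real (card V)"
  shows "\<exists>c. (\<forall>v\<in>V. c v < r) \<and> E \<subseteq> cmult V c"
proof -
  note fin = sgraph_finite[OF G]
  define p where "p = real (card V) / r"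
  have r0: "real r \<ge> 1" "real t \<ge> 2" using r t by auto
  have np: "real (card V) = real r * p" using r0 by (simp add: p_def)
  have deg': "real r * p - p - g \<le> real (card (nbh E v))" if "v \<in> V" for v
  proof -
    have "(1 - 1 / real r) * (real r * p) = real r * p - p" using r0 by (simp add: field_simps)
    then show ?thesis using deg[OF that] by (simp only: np)
  qed
  have g_rg: "g \<le> r * g" using r0 g mult_right_mono[of 1 "real r" g] by simp
  have "real r * (100 * (real r ^ 2 * real t * g)) \<le> real r * p"
    using g(2) np by (simp add: power2_eq_square power3_eq_cube mult_ac)
  then have rrtg: "100 * (real r ^ 2 * real t * g) \<le> p" using r0 by simp
  have "1 * 2 \<le> real r * real t" using r0 by (intro mult_mono) auto
  then have "2 * (real r * g) \<le> (real r * real t) * (real r * g)" using g r0 by (intro mult_right_mono) auto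
  then have rg: "200 * (real r * g) \<le> p" using rrtg by (simp add: power2_eq_square mult_ac)
  have "real r * (10 * real t) \<le> real r * p" using n np by simp
  then have tp: "10 * real t \<le> p" using r0 by simp
  define rg where "rg = real r * g"
  \<comment> \<open>A vertex that avoids a class of size at least \<open>p - 5 * rg\<close> has at
    most \<open>p + g\<close> non-neighbours, so it misses at most
    \<open>5 * rg + g \<le> 6 * rg\<close> vertices outside that class.\<close>
  define D where "D = 6 * rg"
  have rg0: "rg \<ge> 0" "g \<le> rg" "200 * rg \<le> p" using g r0 g_rg rg by (auto simp: rg_def)
  have rtD: "real r * real t * D + real t \<le> p / 4"
  proof -
    have "real r * real t * D = 6 * (real r ^ 2 * real t * g)"
      by (simp add: D_def rg_def power2_eq_square)
    then show ?thesis using rrtg tp g by linarith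
  qed
  have D0: "D \<ge> 0" using rg0 by (simp add: D_def)
  have finA: "finite (A i)" if "i < r" for i using A[OF that] fin finite_subset by blast
  have notin: "real (card V) - real (card S) \<ge> real (card (nbh E v))"
    if "S \<subseteq> V" "nbh E v \<inter> S = {}" for S v
  proof -
    have "nbh E v \<subseteq> V - S" using nbh_subset[OF G] that by blast
    then have "card (nbh E v) \<le> card (V - S)" using fin by (intro card_mono) auto
    also have "\<dots> = card V - card S" using that fin finite_subset by (intro card_Diff_subset) auto
    finally show ?thesis using card_mono[OF fin(1) that(1)] by linarith
  qed
  have Aup: "real (card (A i)) \<le> p + g" if i: "i < r" for i
  proof (cases "A i = {}")
    case True
    then show ?thesis using rg0 g by simp
  next
    case False
    then obtain v where v: "v \<in> A i" by auto
    have "nbh E v \<inter> A i = {}" using indep[OF i] v by (auto simp: nbh_def)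
    from notin[OF A[OF i] this] deg'[of v] show ?thesis using A[OF i] v np by auto
  qed
  have Alow: "p - 5 * rg \<le> real (card (A i))" if i: "i < r" for i
  proof -
    have "(\<Sum>k\<in>{..<r} - {i}. real (card (A k))) \<le> (\<Sum>k\<in>{..<r} - {i}. p + g)"
      by (intro sum_mono Aup) auto
    also have "\<dots> = (real r - 1) * (p + g)" using i by (simp add: of_nat_diff)
    finally have "real r * p - 4 * rg - (real r - 1) * (p + g) \<le> real (card (A i))"
      using total i by (simp add: sum.remove[of "{..<r}" i] np rg_def)
    moreover have "(real r - 1) * (p + g) = real r * p - p + rg - g" by (simp add: rg_def algebra_simps)
    ultimately show ?thesis using g by linarith
  qed
  have miss: "real (card (A j - nbh E v)) \<le> D"
    if "i < r" "j < r" "j \<noteq> i" "v \<in> V" "nbh E v \<inter> A i = {}" for i j v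
  proof -
    have "nbh E v \<inter> (A i \<union> (A j - nbh E v)) = {}" using that by blast
    then have "real (card V) - real (card (A i \<union> (A j - nbh E v))) \<ge> real (card (nbh E v))"
      using A that by (intro notin) auto
    moreover have "card (A i \<union> (A j - nbh E v)) = card (A i) + card (A j - nbh E v)"
      by (rule card_Un_disjoint) (use finA disj[of i j] that in auto)
    ultimately show ?thesis
      using deg'[of v] Alow[of i] that np rg0 by (simp add: D_def)
  qed
  have miss': "real (card (A j - nbh E v)) \<le> D" if "i < r" "j < r" "j \<noteq> i" "v \<in> A i" for i j v
    using miss[of i j v] A[of i] indep[of i _ v] that by (auto simp: nbh_def)
  have nonX: "\<forall>i<r. \<forall>j<r. i \<noteq> j \<longrightarrow> (\<forall>x\<in>X i. real (card (X j - nbh E x)) \<le> D)"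
    if X: "\<And>i. i < r \<Longrightarrow> X i \<subseteq> A i" for X
  proof (intro allI impI ballI)
    fix i j x assume ij: "i < r" "j < r" "i \<noteq> j" "x \<in> X i"
    have "card (X j - nbh E x) \<le> card (A j - nbh E x)"
      using X[OF ij(2)] finA[OF ij(2)] by (intro card_mono) auto
    then show "real (card (X j - nbh E x)) \<le> D"
      using miss'[of i j x] X[OF ij(1)] ij by fastforce
  qed
  have split: "card S \<le> card (S \<inter> nbh E u) + card (S - nbh E u)" if "finite S" for S u
    using card_Un_le[of "S \<inter> nbh E u" "S - nbh E u"] by (simp add: Int_Diff_Un)
  have missing_class: "\<exists>i<r. nbh E v \<inter> A i = {}" if v: "v \<in> V" for v
  proof (rule ccontr)
    assume neg: "\<not> ?thesis"
    let ?f = "\<lambda>j. card (A j \<inter> nbh E v)"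
    \<comment> \<open>The class with the fewest neighbours of \<open>v\<close> is chosen as the home
      of the extra edge; its minimality is what guarantees many neighbours in each other
      class.\<close>
    have "\<exists>i\<in>{..<r}. \<forall>j\<in>{..<r}. ?f i \<le> ?f j"
    proof -
      have "Min (?f ` {..<r}) \<in> ?f ` {..<r}" by (rule Min_in) (use r in \<open>auto simp: lessThan_empty_iff\<close>)
      then obtain i where "i < r" "?f i = Min (?f ` {..<r})" by auto
      then show ?thesis by (intro bexI[of _ i]) auto
    qed
    then obtain i where i: "i < r" "\<And>j. j < r \<Longrightarrow> ?f i \<le> ?f j" by auto
    obtain u where u: "u \<in> nbh E v" "u \<in> A i" using neg i by blast
    have e: "{u, v} \<in> E" using u by (simp add: nbh_def)
    \<comment> \<open>The non-neighbours of \<open>v\<close> in \<open>A i\<close> and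
      \<open>A j\<close> number at most \<open>p + g\<close>, while the two classes have at least
      \<open>2 * p - 10 * rg\<close> vertices. The difference counts neighbours, and at least half
      of them lie in \<open>A j\<close> by the choice of \<open>i\<close>.\<close>
    have half: "p - 11 * rg \<le> 2 * real (?f j)" if j: "j < r" "j \<noteq> i" for j
    proof -
      let ?S = "(A i - nbh E v) \<union> (A j - nbh E v)"
      have "real (card V) - real (card ?S) \<ge> real (card (nbh E v))"
        using A i j by (intro notin) auto
      moreover have "card ?S = card (A i - nbh E v) + card (A j - nbh E v)"
        by (rule card_Un_disjoint) (use finA disj[of i j] i j in auto)
      ultimately show ?thesis
        using split[OF finA[OF i(1)], of v] split[OF finA[OF j(1)], of v] i(2)[OF j(1)]
          deg'[OF v] Alow[OF i(1)] Alow[OF j(1)] np rg0 by linarith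
    qed
    define X where "X j = (if j = i then A i - {u, v} else A j \<inter> nbh E v \<inter> nbh E u)" for j
    have XA: "X j \<subseteq> A j" for j by (auto simp: X_def)
    have "kplus r t V E"
    proof (rule kplus_greedy[OF G i(1) e t D0 _ _ _ nonX[OF XA]])
      show "\<forall>j<r. X j \<subseteq> V" using XA A by blast
      show "\<forall>j<r. j \<noteq> i \<longrightarrow> X j \<subseteq> nbh E u \<inter> nbh E v" by (auto simp: X_def)
      show "X i \<inter> {u, v} = {}" by (simp add: X_def)
      show "\<forall>j<r. real r * real t * D + real t \<le> real (card (X j))"
      proof (intro allI impI)
        fix j assume j: "j < r"
        show "real r * real t * D + real t \<le> real (card (X j))"
        proof (cases "j = i")
          case True
          then show ?thesis
            using card_le_remove_pair[of "A i" u v] Alow[OF i(1)] rtD rg0 tp r0 by (simp add: X_def)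
        next
          case False
          have "card (A j \<inter> nbh E v) \<le> card (X j) + card (A j \<inter> nbh E v - nbh E u)"
            using split[of "A j \<inter> nbh E v" u] finA[OF j] False by (simp add: X_def)
          moreover have "card (A j \<inter> nbh E v - nbh E u) \<le> card (A j - nbh E u)"
            using finA[OF j] by (intro card_mono) auto
          moreover have "real (card (A j - nbh E u)) \<le> D" using miss'[of i j u] i j u False by simp
          ultimately show ?thesis using half[OF j False] rtD rg0 unfolding D_def by linarith
        qed
      qed
    qed
    then show False using free by simp
  qed
  then obtain c where c: "\<And>v. v \<in> V \<Longrightarrow> c v < r \<and> nbh E v \<inter> A (c v) = {}" by metis
  have "c u \<noteq> c v" if e: "{u, v} \<in> E" for u v
  proof
    assume same: "c u = c v"
    note uv = sgraph_edge[OF G e]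
    define i where "i = c v"
    have i: "i < r" "nbh E u \<inter> A i = {}" "nbh E v \<inter> A i = {}"
      using c[OF uv(1)] c[OF uv(2)] same by (auto simp: i_def)
    \<comment> \<open>Neither \<open>u\<close> nor \<open>v\<close> need belong to
      \<open>A i\<close>; both avoid it, so each misses at most \<open>D\<close> vertices of every
      other class.\<close>
    define X where "X j = (if j = i then A i - {u, v} else A j \<inter> nbh E v \<inter> nbh E u)" for j
    have XA: "X j \<subseteq> A j" for j by (auto simp: X_def)
    have "kplus r t V E"
    proof (rule kplus_greedy[OF G i(1) e t D0 _ _ _ nonX[OF XA]])
      show "\<forall>j<r. X j \<subseteq> V" using XA A by blast
      show "\<forall>j<r. j \<noteq> i \<longrightarrow> X j \<subseteq> nbh E u \<inter> nbh E v" by (auto simp: X_def)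
      show "X i \<inter> {u, v} = {}" by (simp add: X_def)
      show "\<forall>j<r. real r * real t * D + real t \<le> real (card (X j))"
      proof (intro allI impI)
        fix j assume j: "j < r"
        show "real r * real t * D + real t \<le> real (card (X j))"
        proof (cases "j = i")
          case True
          then show ?thesis
            using card_le_remove_pair[of "A i" u v] Alow[OF i(1)] rtD rg0 tp r0 by (simp add: X_def)
        next
          case False
          have "card (A j \<inter> nbh E v) \<le> card (X j) + card (A j \<inter> nbh E v - nbh E u)"
            using split[of "A j \<inter> nbh E v" u] finA[OF j] False by (simp add: X_def)
          moreover have "card (A j \<inter> nbh E v - nbh E u) \<le> card (A j - nbh E u)"
            using finA[OF j] by (intro card_mono) auto
          moreover have "card (A j) \<le> card (A j \<inter> nbh E v) + card (A j - nbh E v)"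
            by (rule split[OF finA[OF j]])
          moreover have "real (card (A j - nbh E u)) \<le> D" "real (card (A j - nbh E v)) \<le> D"
            using miss[of i j] i j uv False by auto
          ultimately show ?thesis using Alow[OF j] rtD rg0 unfolding D_def by linarith
        qed
      qed
    qed
    then show False using free by simp
  qed
  then have "E \<subseteq> cmult V c"
  proof (intro subsetI)
    fix x assume neq: "\<And>u v. {u, v} \<in> E \<Longrightarrow> c u \<noteq> c v" and x: "x \<in> E"
    have "card x = 2" using x G by (simp add: sgraph_def)
    then obtain u v where uv: "x = {u, v}" by (auto simp: card_2_iff)
    have "u \<in> V" "v \<in> V" using sgraph_edge[OF G] x uv by auto
    then show "x \<in> cmult V c" using neq[of u v] x uv unfolding cmult_def by blast
  qed
  then show ?thesis using c by (intro exI[of _ c]) simp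
qed

lemma high_degree_colourable:
  fixes r t :: nat
  assumes r: "r \<ge> 1" and t: "t \<ge> 2"
  shows "\<exists>n0. \<forall>(V :: 'a set) E. sgraph (V, E) \<and> n0 \<le> card V \<and> \<not> kplus r t V E
      \<and> (\<forall>v\<in>V. (1 - 1 / r - 1 / (100 * real r ^ 3 * real t)) * real (card V) \<le> real (card (nbh E v)))
    \<longrightarrow> (\<exists>c. (\<forall>v\<in>V. c v < r) \<and> E \<subseteq> cmult V c)"
proof -
  \<comment> \<open>With \<open>g = \<gamma> * n\<close> the smallness condition on \<open>g\<close>
    holds with equality, and \<open>\<gamma>\<close> is also below the slack
    \<open>1 / (2 * r\<^sup>2)\<close> allowed for the skeleton.\<close>
  define \<gamma> where "\<gamma> = 1 / (100 * real r ^ 3 * real t)"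
  have r0: "real r \<ge> 1" "real t \<ge> 2" using r t by auto
  have "2 * real r ^ 2 \<le> 100 * real r ^ 3 * real t"
  proof -
    have "2 * real r ^ 2 * 1 \<le> (100 * real r ^ 2) * (real r * real t)"
      using r0 mult_mono[of 1 "real r" 1 "real t"] by (intro mult_mono) auto
    then show ?thesis by (simp add: power3_eq_cube power2_eq_square mult_ac)
  qed
  then have \<gamma>_le: "\<gamma> \<le> 1 / (2 * (real r)\<^sup>2)"
    unfolding \<gamma>_def using r0 by (intro divide_left_mono) auto
  have \<gamma>0: "\<gamma> > 0" using r0 by (simp add: \<gamma>_def)
  obtain n0 where n0: "\<forall>(V :: 'a set) E. sgraph (V, E) \<and> n0 \<le> card V
      \<and> (\<forall>v\<in>V. (1 - 1 / r - 1 / (2 * (real r)\<^sup>2)) * real (card V) \<le> real (card (nbh E v)))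
    \<longrightarrow> (\<exists>B. (\<forall>i<r. B i \<subseteq> V \<and> card (B i) = 4 * t) \<and> joined E B r)"
    using complete_multipartite_exists[OF r order_refl, of "4 * t"] by (rule exE)
  have "\<exists>c. (\<forall>v\<in>V. c v < r) \<and> E \<subseteq> cmult V c"
    if G: "sgraph (V, E)" and n: "max n0 (10 * r * t) \<le> card V" and free: "\<not> kplus r t V E"
      and deg: "\<forall>v\<in>V. (1 - 1 / r - \<gamma>) * real (card V) \<le> real (card (nbh E v))" for V :: "'a set" and E
  proof -
    have "(1 - 1 / r - 1 / (2 * (real r)\<^sup>2)) * real (card V) \<le> (1 - 1 / r - \<gamma>) * real (card V)"
      using \<gamma>_le by (intro mult_right_mono) auto
    then have "\<forall>v\<in>V. (1 - 1 / r - 1 / (2 * (real r)\<^sup>2)) * real (card V) \<le> real (card (nbh E v))"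
      using deg by (meson order_trans)
    then obtain B where B: "\<forall>i<r. B i \<subseteq> V \<and> card (B i) = 4 * t" "joined E B r"
      using n0[THEN spec, THEN spec, THEN mp, of V E] G n by auto
    have deg': "\<forall>v\<in>V. (1 - 1 / r) * real (card V) - \<gamma> * card V \<le> real (card (nbh E v))"
      using deg by (simp add: left_diff_distrib)
    obtain A where A: "\<forall>i<r. A i \<subseteq> V \<and> (\<forall>u\<in>A i. \<forall>v\<in>A i. {u, v} \<notin> E)"
      "\<forall>i<r. \<forall>j<r. i \<noteq> j \<longrightarrow> A i \<inter> A j = {}"
      "real (card V) - 4 * real r * (\<gamma> * card V) \<le> (\<Sum>i<r. real (card (A i)))"
      using independent_classes[OF G r t free B deg'] by blast
    show ?thesis
    proof (rule colourable_of_independent_classes[OF G r t free _ _ _ A(3)])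
      show "0 \<le> \<gamma> * real (card V)" using \<gamma>0 by simp
      show "100 * real r ^ 3 * real t * (\<gamma> * real (card V)) \<le> real (card V)"
        using r0 by (simp add: \<gamma>_def)
      have "real (10 * r * t) \<le> real (card V)" using n by (simp only: of_nat_le_iff)
      then show "10 * real r * real t \<le> real (card V)" by simp
      show "(1 - 1 / real r) * real (card V) - \<gamma> * real (card V) \<le> real (card (nbh E v))" if "v \<in> V" for v
        using deg' that by blast
    qed (use A in blast)+
  qed
  then show ?thesis unfolding \<gamma>_def by (intro exI[of _ "max n0 (10 * r * t)"]) blast
qed

section \<open>Progressive induction\<close>

lemma card_edges_le:
  assumes G: "sgraph (V, E)"
  shows "card E \<le> (card V)\<^sup>2"
proof -
  have "E \<subseteq> (\<lambda>(u, v). {u, v}) ` (V \<times> V)"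
  proof
    fix e assume e: "e \<in> E"
    then have "card e = 2" "e \<subseteq> V" using G by (auto simp: sgraph_def)
    then show "e \<in> (\<lambda>(u, v). {u, v}) ` (V \<times> V)" by (auto simp: card_2_iff)
  qed
  then have "card E \<le> card (V \<times> V)"
    using sgraph_finite[OF G] by (meson card_image_le card_mono finite_SigmaI finite_imageI le_trans)
  then show ?thesis by (simp add: card_cartesian_product power2_eq_square)
qed

lemma sgraph_cmult: "finite V \<Longrightarrow> sgraph (V, cmult V c)"
  by (auto simp: sgraph_def card_cmult_edge) (auto simp: cmult_def)

lemma mnum_le_card_vertices:
  assumes "sgraph (V, E)"
  shows "mnum l E \<le> card V ^ (2 * l)"
proof -
  have "mnum l E \<le> card E ^ l" by (rule mnum_le_power) (rule sgraph_finite[OF assms])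
  also have "\<dots> \<le> ((card V)\<^sup>2) ^ l" by (intro power_mono card_edges_le assms) simp
  finally show ?thesis by (simp add: power_mult)
qed

section \<open>Growth of the Turan count\<close>

lemma tnum_0: "tnum r 0 n = 1"
  by (simp add: tnum_def turan_eq_cmult mnum_0 finite_cmult)

text \<open>Since classes are residues, deleting the last vertex of a Turan graph leaves the smaller
  Turan graph, so the recursion at that vertex gives the increment.\<close>

lemma tnum_Suc:
  "tnum r (Suc l) (Suc n) = tnum r (Suc l) n
    + (\<Sum>y\<in>{y \<in> {0..<n}. y mod r \<noteq> n mod r}. mnum l (cmult ({0..<Suc n} - {n, y}) (\<lambda>i. i mod r)))"
proof -
  have "{y \<in> {0..<Suc n}. y mod r \<noteq> n mod r} = {y \<in> {0..<n}. y mod r \<noteq> n mod r}" by (auto simp: less_Suc_eq)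
  moreover have "{0..<Suc n} - {n} = {0..<n}" by auto
  ultimately show ?thesis
    using mnum_cmult_rec[of "{0..<Suc n}" n l "\<lambda>i. i mod r"] by (simp only: tnum_def turan_eq_cmult) simp
qed

text \<open>The last vertex has at least \<open>n - n div r\<close> neighbours. Deleting it together
  with a neighbour leaves a copy of the Turan graph on \<open>Suc n - r\<close> vertices: the last
  \<open>r\<close> numbers are given up, and one of them replaces the neighbour when it lies
  below.\<close>

lemma tnum_Suc_ge:
  assumes r: "r > 0"
  shows "tnum r (Suc l) n + (n - n div r) * tnum r l (Suc n - r) \<le> tnum r (Suc l) (Suc n)"
proof -
  let ?Y = "{y \<in> {0..<n}. y mod r \<noteq> n mod r}" and ?Z = "{y \<in> {0..<n}. y mod r = n mod r}"
  have "card ?Z \<le> card {..<n div r}"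
  proof (rule card_inj_on_le[where f = "\<lambda>y. y div r"])
    show "inj_on (\<lambda>y. y div r) ?Z"
      by (rule inj_onI) (metis (mono_tags, lifting) div_mult_mod_eq mem_Collect_eq)
    show "(\<lambda>y. y div r) ` ?Z \<subseteq> {..<n div r}"
    proof
      fix k assume "k \<in> (\<lambda>y. y div r) ` ?Z"
      then obtain y where y: "y < n" "y mod r = n mod r" "k = y div r" by auto
      have "y div r \<le> n div r" using y by (intro div_le_mono) simp
      moreover have "y div r \<noteq> n div r" using y by (metis div_mult_mod_eq less_irrefl)
      ultimately show "k \<in> {..<n div r}" using y by simp
    qed
  qed simp
  moreover have "card ?Y + card ?Z = card (?Y \<union> ?Z)"
    by (rule card_Un_disjoint[symmetric]) auto
  moreover have "?Y \<union> ?Z = {0..<n}" by auto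
  ultimately have cY: "n - n div r \<le> card ?Y" by simp
  have term_ge: "tnum r l (Suc n - r) \<le> mnum l (cmult ({0..<Suc n} - {n, y}) (\<lambda>i. i mod r))" if y: "y \<in> ?Y" for y
  proof -
    \<comment> \<open>\<open>z\<close> is the vertex congruent to \<open>y\<close> among the last \<open>r\<close>; it replaces \<open>y\<close> in the embedding.\<close>
    define z where "z = y + r * ((n - y) div r)"
    have zm: "z mod r = y mod r" by (simp add: z_def)
    have "n = z + (n - y) mod r"
      using y mult_div_mod_eq[of r "n - y"] by (simp add: z_def)
    moreover have "(n - y) mod r < r" using r by simp
    ultimately have z: "z \<le> n" "n < z + r" by linarith+
    have "z \<noteq> n" using zm y by auto
    with z have z': "z < n" "n < z + r" by auto
    show ?thesis
      unfolding tnum_def turan_eq_cmult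
    proof (rule mnum_cmult_embed[where h = "\<lambda>v. if v = y then z else v"])
      show "inj_on (\<lambda>v. if v = y then z else v) {0..<Suc n - r}"
        using z' by (auto simp: inj_on_def)
      have "z \<noteq> y" if "y < Suc n - r" using that z' by auto
      then show "(\<lambda>v. if v = y then z else v) ` {0..<Suc n - r} \<subseteq> {0..<Suc n} - {n, y}"
        using z' r by auto
    qed (auto simp: zm)
  qed
  have "(n - n div r) * tnum r l (Suc n - r) \<le> card ?Y * tnum r l (Suc n - r)"
    using cY by (rule mult_le_mono1)
  also have "\<dots> = (\<Sum>y\<in>?Y. tnum r l (Suc n - r))" by simp
  also have "\<dots> \<le> (\<Sum>y\<in>?Y. mnum l (cmult ({0..<Suc n} - {n, y}) (\<lambda>i. i mod r)))"
    by (rule sum_mono) (rule term_ge)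
  finally show ?thesis by (simp only: tnum_Suc)
qed

text \<open>Both sides carry the factor \<open>m + j\<close> so that the exponent \<open>2 * l - 1\<close>, which truncates for \<open>l = 0\<close>, is avoided.\<close>

lemma tnum_growth:
  "tnum r l (m + j) * (m + j) \<le> tnum r l m * (m + j) + j * (m + j) ^ (2 * l)"
proof (cases l)
  case 0
  then show ?thesis by (simp add: tnum_0)
next
  case (Suc l')
  have step: "tnum r (Suc l') (Suc n) \<le> tnum r (Suc l') n + Suc n ^ (2 * l' + 1)" for n
  proof -
    have "mnum l' (cmult ({0..<Suc n} - {n, y}) (\<lambda>i. i mod r)) \<le> Suc n ^ (2 * l')" for y
    proof -
      have "mnum l' (cmult ({0..<Suc n} - {n, y}) (\<lambda>i. i mod r)) \<le> card ({0..<Suc n} - {n, y}) ^ (2 * l')"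
        by (intro mnum_le_card_vertices sgraph_cmult) simp
      also have "\<dots> \<le> Suc n ^ (2 * l')"
        using card_mono[of "{0..<Suc n}" "{0..<Suc n} - {n, y}"] by (intro power_mono) auto
      finally show ?thesis .
    qed
    then have "(\<Sum>y\<in>{y \<in> {0..<n}. y mod r \<noteq> n mod r}. mnum l' (cmult ({0..<Suc n} - {n, y}) (\<lambda>i. i mod r)))
        \<le> (\<Sum>y\<in>{y \<in> {0..<n}. y mod r \<noteq> n mod r}. Suc n ^ (2 * l'))"
      by (intro sum_mono)
    also have "\<dots> = card {y \<in> {0..<n}. y mod r \<noteq> n mod r} * Suc n ^ (2 * l')" by simp
    also have "\<dots> \<le> Suc n * Suc n ^ (2 * l')"
    proof (rule mult_le_mono1)
      have "card {y \<in> {0..<n}. y mod r \<noteq> n mod r} \<le> card {0..<n}" by (rule card_mono) auto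
      then show "card {y \<in> {0..<n}. y mod r \<noteq> n mod r} \<le> Suc n" by simp
    qed
    finally show ?thesis by (simp add: tnum_Suc)
  qed
  have "tnum r (Suc l') (m + j) \<le> tnum r (Suc l') m + j * (m + j) ^ (2 * l' + 1)" for j
  proof (induction j)
    case (Suc j)
    have "tnum r (Suc l') (m + Suc j) \<le> tnum r (Suc l') (m + j) + (m + Suc j) ^ (2 * l' + 1)"
      using step[of "m + j"] by simp
    also have "\<dots> \<le> tnum r (Suc l') m + j * (m + j) ^ (2 * l' + 1) + (m + Suc j) ^ (2 * l' + 1)"
      using Suc.IH by simp
    also have "\<dots> \<le> tnum r (Suc l') m + j * (m + Suc j) ^ (2 * l' + 1) + (m + Suc j) ^ (2 * l' + 1)"
      by (intro add_mono mult_le_mono power_mono) auto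
    finally show ?case by simp
  qed simp
  then have "tnum r l (m + j) * (m + j) \<le> (tnum r l m + j * (m + j) ^ (2 * l' + 1)) * (m + j)"
    unfolding Suc by (intro mult_le_mono1)
  then show ?thesis by (simp add: Suc algebra_simps)
qed

text \<open>Sum the last half of the increments. For \<open>r \<ge> 2\<close> each increment is at
  least a constant times \<open>n\<close>, times the count for \<open>l\<close>, so two powers of
  \<open>n\<close> are gained per edge.\<close>

lemma tnum_lower_bound:
  assumes r: "r \<ge> 2"
  shows "\<exists>c>0. \<exists>n0. \<forall>n\<ge>n0. c * real n ^ (2 * l) \<le> real (tnum r l n)"
proof (induction l)
  case 0
  show ?case by (intro exI[of _ 1]) (simp add: tnum_0)
next
  case (Suc l)
  then obtain c n0 where c: "c > 0" and n0: "\<And>n. n \<ge> n0 \<Longrightarrow> c * real n ^ (2 * l) \<le> real (tnum r l n)"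
    by blast
  define x where "x n = real n / 2 * (c * (real n / 2) ^ (2 * l))" for n :: nat
  have step: "real (tnum r (Suc l) k) + x n \<le> real (tnum r (Suc l) (Suc k))"
    if n: "n \<ge> 2 * r + n0" and k: "k \<ge> n" for n k
  proof -
    have "k div r \<le> k div 2" using r by (intro div_le_mono2) auto
    then have "k \<le> 2 * (k - k div r)" by linarith
    then have 1: "real n / 2 \<le> real (k - k div r)" using k by linarith
    have "real n / 2 \<le> real (Suc k - r)" using n k by linarith
    then have "c * (real n / 2) ^ (2 * l) \<le> c * real (Suc k - r) ^ (2 * l)"
      using c by (intro mult_left_mono power_mono) auto
    also have "\<dots> \<le> real (tnum r l (Suc k - r))" by (rule n0) (use n k in linarith)
    finally have "x n \<le> real (k - k div r) * real (tnum r l (Suc k - r))"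
      unfolding x_def using 1 c by (intro mult_mono) auto
    moreover have "real (tnum r (Suc l) k + (k - k div r) * tnum r l (Suc k - r)) \<le> real (tnum r (Suc l) (Suc k))"
      by (simp only: of_nat_le_iff, rule tnum_Suc_ge) (use r in simp)
    ultimately show ?thesis by simp
  qed
  have steps: "real m * x n \<le> real (tnum r (Suc l) (n + m))" if n: "n \<ge> 2 * r + n0" for n m
  proof (induction m)
    case (Suc m)
    then show ?case using step[OF n, of "n + m"] by (simp add: algebra_simps)
  qed simp
  \<comment> \<open>The constant of the product
    \<open>(N / 2) * (N / 6) * (c * (N / 6) ^ (2 * l))\<close>: there are at least
    \<open>N / 2\<close> increments starting from \<open>n = N div 2\<close>, and
    \<open>n / 2 \<ge> N / 6\<close>.\<close>
  define c' where "c' = c / (12 * 6 ^ (2 * l))"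
  have "c' * real N ^ (2 * Suc l) \<le> real (tnum r (Suc l) N)" if N: "N \<ge> 2 * (2 * r + n0) + 4" for N
  proof -
    define n m where "n = N div 2" and "m = N - n"
    have nm: "n + m = N" "n \<ge> 2 * r + n0" "real N / 6 \<le> real n / 2" "real N / 2 \<le> real m"
      using N by (auto simp: n_def m_def)
    have "c' * real N ^ (2 * Suc l) = real N / 2 * (real N / 6 * (c * (real N / 6) ^ (2 * l)))"
    proof -
      have "real N ^ (2 * Suc l) = real N * real N * real N ^ (2 * l)" by (simp add: mult.assoc)
      then show ?thesis by (simp only: c'_def power_divide) simp
    qed
    also have "\<dots> \<le> real m * x n"
      unfolding x_def using nm c by (intro mult_mono power_mono) auto
    also have "\<dots> \<le> real (tnum r (Suc l) (n + m))" by (rule steps[OF nm(2)])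
    finally show ?thesis by (simp add: nm)
  qed
  moreover have "c' > 0" using c by (simp add: c'_def)
  ultimately show ?case by blast
qed

text \<open>Here \<open>d\<close> is the degree of a deleted vertex, and \<open>n - 1\<close>
  vertices remain after deleting it with one neighbour. Passing from \<open>n - 1\<close> to
  \<open>Suc n - r\<close> vertices changes the count for \<open>l\<close> by little, which costs
  order \<open>n ^ (2 * l)\<close> over all \<open>d\<close> edges; the degree deficit gains order
  \<open>n ^ (2 * l + 1)\<close>.\<close>

lemma tnum_gap:
  fixes \<gamma> :: real
  assumes r: "r \<ge> 1" and \<gamma>: "\<gamma> > 0"
  shows "\<exists>n0. \<forall>n\<ge>n0. \<forall>d. real d < (1 - 1 / r - \<gamma>) * real (Suc n) \<longrightarrow>
    tnum r (Suc l) n + d * tnum r l (n - 1) + 1 \<le> tnum r (Suc l) (Suc n)"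
proof (cases "r = 1")
  case True
  \<comment> \<open>For one class the premise on \<open>d\<close> is never satisfied.\<close>
  have "(1 - 1 / r - \<gamma>) * real (Suc n) \<le> 0" for n
    using \<gamma> True by (simp add: mult_nonpos_nonneg)
  then have "\<not> real d < (1 - 1 / r - \<gamma>) * real (Suc n)" for n d
    using order_trans[of _ 0 "real d"] by (simp only: not_less of_nat_0_le_iff)
  then show ?thesis by blast
next
  case False
  then have r2: "r \<ge> 2" using r by simp
  obtain c n0 where c: "c > 0" and n0: "\<And>n. n \<ge> n0 \<Longrightarrow> c * real n ^ (2 * l) \<le> real (tnum r l n)"
    using tnum_lower_bound[OF r2] by blast
  \<comment> \<open>Chosen so that \<open>\<gamma> * n - 1\<close> times the lower bound
    \<open>c / 4 ^ l * X\<close> for \<open>?f'\<close> is at least \<open>3 * r * X + X\<close>,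
    which covers the error term and the extra unit.\<close>
  define n1 where "n1 = nat \<lceil>((3 * r + 1) * 4 ^ l / c + 1) / \<gamma>\<rceil>"
  show ?thesis
  proof (intro exI[of _ "n1 + n0 + 2 * r + 2"] allI impI)
    fix n d assume n: "n \<ge> n1 + n0 + 2 * r + 2" and d: "real d < (1 - 1 / r - \<gamma>) * real (Suc n)"
    let ?f = "real (tnum r l (n - 1))" and ?f' = "real (tnum r l (Suc n - r))"
    let ?N = "real (n - 1)"
    define X where "X = ?N ^ (2 * l)"
    have N: "?N \<ge> 1" using n by linarith
    then have X: "X \<ge> 1" unfolding X_def by (rule one_le_power)
    have "n - 1 = (Suc n - r) + (r - 2)" using n r2 by linarith
    then have "tnum r l (n - 1) * (n - 1) \<le> tnum r l (Suc n - r) * (n - 1) + (r - 2) * (n - 1) ^ (2 * l)"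
      using tnum_growth[of r l "Suc n - r" "r - 2"] by simp
    also have "\<dots> \<le> tnum r l (Suc n - r) * (n - 1) + r * (n - 1) ^ (2 * l)" by simp
    finally have "real (tnum r l (n - 1) * (n - 1)) \<le> real (tnum r l (Suc n - r) * (n - 1) + r * (n - 1) ^ (2 * l))"
      by (simp only: of_nat_le_iff)
    then have "?f * ?N \<le> ?f' * ?N + r * X"
      by (simp only: of_nat_mult of_nat_add of_nat_power X_def)
    then have fN: "(?f - ?f') * ?N \<le> r * X" by (simp add: left_diff_distrib)
    have coef: "real d \<le> (1 - 1 / r) * real n + 1 - \<gamma> * real n" "real d \<le> 3 * ?N"
    proof -
      have "(1 - q - \<gamma>) * real (Suc n) = (1 - q) * real n + 1 - \<gamma> * real n - q - \<gamma>" for q :: real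
        by (simp add: algebra_simps)
      note e = this[of "1 / r"]
      have pos: "1 / real r > 0" using r2 by simp
      show "real d \<le> (1 - 1 / r) * real n + 1 - \<gamma> * real n" using d e pos \<gamma> by linarith
      have "real d \<le> (1 - 1 / r - \<gamma>) * real (Suc n)" by (rule less_imp_le[OF d])
      also have "\<dots> \<le> 1 * real (Suc n)"
        using pos \<gamma> by (intro mult_right_mono) linarith+
      also have "\<dots> = real (Suc n)" by simp
      also have "\<dots> \<le> 3 * ?N" using n by linarith
      finally show "real d \<le> 3 * ?N" .
    qed
    \<comment> \<open>The bound \<open>d \<le> 3 * ?N\<close> can be multiplied in only if the
      difference is nonnegative; otherwise the left-hand side is already at most zero.\<close>
    have a1: "real d * (?f - ?f') \<le> 3 * (r * X)"
    proof (cases "?f \<le> ?f'")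
      case True
      then have "real d * (?f - ?f') \<le> 0" by (simp add: mult_nonneg_nonpos)
      moreover have "0 \<le> 3 * (r * X)" using X by simp
      ultimately show ?thesis by linarith
    next
      case False
      then have "real d * (?f - ?f') \<le> 3 * ?N * (?f - ?f')" by (intro mult_right_mono coef) auto
      then show ?thesis using fN by (simp add: algebra_simps)
    qed
    define q where "q = 1 - 1 / real r"
    have a2: "real d * ?f' \<le> (q * real n + 1 - \<gamma> * real n) * ?f'"
      unfolding q_def by (intro mult_right_mono coef) auto
    have a3: "real d * (?f - ?f') = real d * ?f - real d * ?f'"
      by (simp add: algebra_simps)
    have "(q * real n + 1 - \<gamma> * real n) * ?f' = q * real n * ?f' - (\<gamma> * real n - 1) * ?f'"
      by (simp add: algebra_simps)
    then have 1: "real d * ?f \<le> q * real n * ?f' - (\<gamma> * real n - 1) * ?f' + 3 * (r * X)"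
      using a1 a2 a3 by linarith
    have "?N / 2 \<le> real (Suc n - r)" using n by linarith
    then have "c * (?N / 2) ^ (2 * l) \<le> c * real (Suc n - r) ^ (2 * l)"
      using c by (intro mult_left_mono power_mono) auto
    also have "\<dots> \<le> ?f'" by (rule n0) (use n in linarith)
    finally have f': "c / 4 ^ l * X \<le> ?f'" by (simp add: X_def power_divide power_mult)
    have "((3 * r + 1) * 4 ^ l / c + 1) / \<gamma> \<le> real n1" unfolding n1_def by linarith
    then have "((3 * r + 1) * 4 ^ l / c + 1) / \<gamma> \<le> real n" using n by linarith
    then have "(3 * r + 1) * 4 ^ l / c + 1 \<le> real n * \<gamma>" using \<gamma> by (simp only: pos_divide_le_eq)
    then have g: "(3 * r + 1) * 4 ^ l / c \<le> \<gamma> * real n - 1" by (simp add: mult.commute)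
    moreover have "0 \<le> (3 * r + 1) * 4 ^ l / c" using c by simp
    ultimately have "0 \<le> \<gamma> * real n - 1" by linarith
    then have "(3 * r + 1) * 4 ^ l / c * (c / 4 ^ l * X) \<le> (\<gamma> * real n - 1) * ?f'"
      using f' c X g by (intro mult_mono) simp_all
    moreover have "(3 * r + 1) * 4 ^ l / c * (c / 4 ^ l * X) = 3 * (r * X) + X"
      using c by (simp add: field_simps)
    ultimately have 2: "3 * (r * X) + 1 \<le> (\<gamma> * real n - 1) * ?f'"
      using X by linarith
    have "real (n div r) \<le> real n / r" by (rule of_nat_div_le_of_nat)
    moreover have "real (n - n div r) = real n - real (n div r)" by (simp add: of_nat_diff)
    ultimately have "q * real n \<le> real (n - n div r)" unfolding q_def by (simp add: left_diff_distrib)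
    then have 3: "q * real n * ?f' \<le> real (n - n div r) * ?f'" by (rule mult_right_mono) simp
    have "real d * ?f + 1 \<le> real (n - n div r) * ?f'" using 1 2 3 by linarith
    then have "real (d * tnum r l (n - 1) + 1) \<le> real ((n - n div r) * tnum r l (Suc n - r))" by simp
    then have "d * tnum r l (n - 1) + 1 \<le> (n - n div r) * tnum r l (Suc n - r)"
      by (simp only: of_nat_le_iff)
    then show "tnum r (Suc l) n + d * tnum r l (n - 1) + 1 \<le> tnum r (Suc l) (Suc n)"
      using tnum_Suc_ge[of r l n] r by linarith
  qed
qed

section \<open>Induction on the number of vertices\<close>

lemma sgraph_del: "sgraph (V, E) \<Longrightarrow> sgraph (V - X, del E X)"
  by (auto simp: sgraph_def del_def)

lemma kplus_del: "kplus r t (V - X) (del E X) \<Longrightarrow> kplus r t V E"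
proof -
  assume "kplus r t (V - X) (del E X)"
  then obtain P i u v where P: "i < r" "joined (del E X) P r" "\<forall>j<r. P j \<subseteq> V - X \<and> card (P j) = t"
    "u \<in> P i" "v \<in> P i" "{u, v} \<in> del E X" unfolding kplus_def by blast
  have "joined E P r" using P(2) del_subset[of E X] unfolding joined_def by blast
  moreover have "\<forall>j<r. P j \<subseteq> V \<and> card (P j) = t" using P(3) by blast
  moreover have "{u, v} \<in> E" using P(6) del_subset[of E X] by blast
  ultimately show ?thesis using P(1,4,5) unfolding kplus_def by blast
qed

text \<open>The outer induction on \<open>l\<close> supplies the bound for the graphs left by
  deleting both ends of an edge, the inner one for the graph left by deleting a vertex. The inner
  induction has no exact base case, so it carries an excess that has died out once the graph is
  large.\<close>

lemma mnum_le_tnum: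
  assumes r: "r \<ge> 1" and t: "t \<ge> 2"
  shows "\<exists>n0. \<forall>(V :: 'a set) E. sgraph (V, E) \<and> n0 \<le> card V \<and> \<not> kplus r t V E
    \<longrightarrow> mnum l E \<le> tnum r l (card V)"
proof (induction l)
  case 0
  show ?case by (intro exI[of _ 0] allI impI) (auto simp: mnum_0 tnum_0 dest: sgraph_finite)
next
  case (Suc l)
  define \<gamma> where "\<gamma> = 1 / (100 * real r ^ 3 * real t)"
  have \<gamma>: "\<gamma> > 0" using r t by (simp add: \<gamma>_def)
  obtain n0 where n0: "\<And>(V :: 'a set) E. sgraph (V, E) \<Longrightarrow> n0 \<le> card V \<Longrightarrow> \<not> kplus r t V E
      \<Longrightarrow> mnum l E \<le> tnum r l (card V)"
    using Suc.IH by blast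
  obtain n1 where n1: "\<forall>(V :: 'a set) E. sgraph (V, E) \<and> n1 \<le> card V \<and> \<not> kplus r t V E
      \<and> (\<forall>v\<in>V. (1 - 1 / r - \<gamma>) * real (card V) \<le> real (card (nbh E v)))
    \<longrightarrow> (\<exists>c. (\<forall>v\<in>V. c v < r) \<and> E \<subseteq> cmult V c)"
    using high_degree_colourable[OF r t] unfolding \<gamma>_def by (rule exE)
  obtain n2 where n2: "\<And>n d. n \<ge> n2 \<Longrightarrow> real d < (1 - 1 / r - \<gamma>) * real (Suc n) \<Longrightarrow>
      tnum r (Suc l) n + d * tnum r l (n - 1) + 1 \<le> tnum r (Suc l) (Suc n)"
    using tnum_gap[OF r \<gamma>, of l] by blast
  \<comment> \<open>Above all thresholds at once, with room for \<open>n0\<close>, which is applied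
    after two vertices have been deleted.\<close>
  define N where "N = n0 + n1 + n2 + 2"
  define C where "C = N ^ (2 * Suc l)"
  \<comment> \<open>\<open>C\<close> bounds the excess at \<open>N\<close> vertices; each further vertex uses up one unit, and the truncated \<open>C - k\<close> vanishes once \<open>k \<ge> C\<close>.\<close>
  have claim: "mnum (Suc l) E \<le> tnum r (Suc l) (card V) + (C - k)"
    if "sgraph (V, E)" "card V = N + k" "\<not> kplus r t V E" for V :: "'a set" and E k
    using that
  proof (induction k arbitrary: V E)
    case 0
    then show ?case using mnum_le_card_vertices[OF 0(1), of "Suc l"] by (simp add: C_def)
  next
    case (Suc k)
    note fin = sgraph_finite[OF Suc.prems(1)]
    show ?case
    proof (cases "\<forall>v\<in>V. (1 - 1 / r - \<gamma>) * real (card V) \<le> real (card (nbh E v))")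
      case True
      then obtain c where c: "\<forall>v\<in>V. c v < r" "E \<subseteq> cmult V c"
        using n1[THEN spec, THEN spec, THEN mp, of V E] Suc.prems by (auto simp: N_def)
      have "mnum (Suc l) E \<le> mnum (Suc l) (cmult V c)"
        by (rule mnum_mono[OF c(2)]) (simp add: finite_cmult fin)
      also have "\<dots> \<le> tnum r (Suc l) (card V)"
        by (rule mnum_cmult_le_tnum) (use fin r c in auto)
      finally show ?thesis by simp
    next
      case False
      then obtain v where v: "v \<in> V" "real (card (nbh E v)) < (1 - 1 / r - \<gamma>) * real (card V)"
        by (auto simp: not_le)
      define n where "n = N + k"
      have cV: "card V = Suc n" using Suc.prems by (simp add: n_def)
      have free: "\<not> kplus r t (V - X) (del E X)" for X
        using Suc.prems(3) kplus_del by blast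
      have "mnum (Suc l) (del E {v}) \<le> tnum r (Suc l) (card (V - {v})) + (C - k)"
        by (rule Suc.IH[OF sgraph_del[OF Suc.prems(1)] _ free]) (use Suc.prems v in simp)
      then have 1: "mnum (Suc l) (del E {v}) \<le> tnum r (Suc l) n + (C - k)"
        using v cV by simp
      have 2: "mnum l (del E {v, u}) \<le> tnum r l (n - 1)" if u: "u \<in> nbh E v" for u
      proof -
        have "{u, v} \<in> E" using u by (simp add: nbh_def)
        note uv = sgraph_edge[OF Suc.prems(1) this]
        then have "card (V - {v, u}) = n - 1" using cV fin by (simp add: card_Diff_subset)
        then show ?thesis
          using n0[OF sgraph_del[OF Suc.prems(1)] _ free, of "{v, u}"] by (simp add: n_def N_def)
      qed
      have "(\<Sum>u\<in>nbh E v. mnum l (del E {v, u})) \<le> (\<Sum>u\<in>nbh E v. tnum r l (n - 1))"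
        by (rule sum_mono) (rule 2)
      moreover have "mnum (Suc l) E = mnum (Suc l) (del E {v}) + (\<Sum>u\<in>nbh E v. mnum l (del E {v, u}))"
        by (rule mnum_rec) (use fin Suc.prems(1) in \<open>auto simp: sgraph_def\<close>)
      ultimately have "mnum (Suc l) E \<le> tnum r (Suc l) n + (C - k) + card (nbh E v) * tnum r l (n - 1)"
        using 1 by simp
      moreover have "tnum r (Suc l) n + card (nbh E v) * tnum r l (n - 1) + 1 \<le> tnum r (Suc l) (card V)"
        using n2[of n "card (nbh E v)"] v(2) by (simp add: cV n_def N_def)
      ultimately show ?thesis by linarith
    qed
  qed
  have "mnum (Suc l) E \<le> tnum r (Suc l) (card V)"
    if "sgraph (V, E)" "N + C \<le> card V" "\<not> kplus r t V E" for V :: "'a set" and E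
    using claim[OF that(1) _ that(3), of "card V - N"] that(2) by simp
  then show ?case by blast
qed

section \<open>Subgraph counts and colourings\<close>

lemma matching_edges: "snd (matching l) = (\<lambda>i. {2 * i, 2 * i + 1}) ` {..<l}"
  by (auto simp: matching_def)

lemma graph_iso_matching_imp:
  assumes iso: "graph_iso (U, M) (matching l)" and MU: "\<forall>e\<in>M. e \<subseteq> U"
  shows "U = \<Union>M" "card M = l" "pairwise disjnt M"
proof -
  obtain f where f: "bij_betw f U {0..<2 * l}"
    and edges: "(\<lambda>i. {2 * i, 2 * i + 1}) ` {..<l} = (`) f ` M"
    using iso by (auto simp: graph_iso_def matching_edges) (auto simp: matching_def)
  have inj: "inj_on f U" using f by (simp add: bij_betw_def)
  have injM: "inj_on ((`) f) M"
    using MU inj by (meson inj_on_image_eq_iff inj_onI)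
  have "inj_on (\<lambda>i::nat. {2 * i, 2 * i + 1}) {..<l}"
    by (rule inj_onI) (auto simp: doubleton_eq_iff)
  then have "card ((\<lambda>i. {2 * i, 2 * i + 1}) ` {..<l}) = l" by (simp add: card_image)
  then show "card M = l" using card_image[OF injM] by (simp only: edges)
  show "pairwise disjnt M"
  proof (rule pairwiseI)
    fix e e' assume e: "e \<in> M" "e' \<in> M" "e \<noteq> e'"
    have "f ` e \<in> (\<lambda>i. {2 * i, 2 * i + 1}) ` {..<l}" "f ` e' \<in> (\<lambda>i. {2 * i, 2 * i + 1}) ` {..<l}"
      unfolding edges using e by blast+
    then obtain i j where ij: "f ` e = {2 * i, 2 * i + 1}" "f ` e' = {2 * j, 2 * j + 1}" by blast
    have "f ` e \<noteq> f ` e'" using injM e by (auto simp: inj_on_def)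
    then have "i \<noteq> j" using ij by auto
    then have "2 * i \<noteq> 2 * j" "2 * i \<noteq> 2 * j + 1" "2 * i + 1 \<noteq> 2 * j" "2 * i + 1 \<noteq> 2 * j + 1"
      by presburger+
    then have "f ` e \<inter> f ` e' = {}" unfolding ij by blast
    then show "disjnt e e'" by (auto simp: disjnt_def)
  qed
  show "U = \<Union>M"
  proof
    show "\<Union>M \<subseteq> U" using MU by blast
    show "U \<subseteq> \<Union>M"
    proof
      fix x assume x: "x \<in> U"
      then have "f x < 2 * l" using bij_betwE[OF f] by auto
      then have i: "f x div 2 \<in> {..<l}" by auto
      have "f x \<in> {2 * (f x div 2), 2 * (f x div 2) + 1}" by auto
      moreover have "{2 * (f x div 2), 2 * (f x div 2) + 1} \<in> (`) f ` M"
        unfolding edges[symmetric] using i by (rule imageI)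
      ultimately obtain e where e: "e \<in> M" "f x \<in> f ` e" by auto
      then obtain y where "y \<in> e" "f x = f y" by blast
      then show "x \<in> \<Union>M" using e MU x inj by (metis UnionI inj_onD subsetD)
    qed
  qed
qed

text \<open>Enumerate the edges and order each pair: the ends of edge \<open>i\<close> receive the
  numbers \<open>2 * i\<close> and \<open>2 * i + 1\<close>. Disjointness of the edges makes this
  numbering injective.\<close>

lemma graph_iso_matchingI:
  assumes two: "\<forall>e\<in>M. card e = 2" and l: "card M = l" and fin: "finite M" and disj: "pairwise disjnt M"
  shows "graph_iso (\<Union>M, M) (matching l)"
proof -
  obtain m where m: "bij_betw m {0..<l} M" using ex_bij_betw_nat_finite[OF fin] l by auto
  have "\<forall>i. \<exists>a b. i < l \<longrightarrow> m i = {a, b} \<and> a \<noteq> b"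
  proof
    fix i
    show "\<exists>a b. i < l \<longrightarrow> m i = {a, b} \<and> a \<noteq> b"
    proof (cases "i < l")
      case True
      then have "card (m i) = 2" using bij_betwE[OF m] two by auto
      then show ?thesis by (auto simp: card_2_iff)
    qed auto
  qed
  then obtain a b where ab: "\<And>i. i < l \<Longrightarrow> m i = {a i, b i} \<and> a i \<noteq> b i" by metis
  define g where "g k = (if even k then a (k div 2) else b (k div 2))" for k
  have gm: "g k \<in> m (k div 2)" if "k < 2 * l" for k
    using ab[of "k div 2"] that by (auto simp: g_def)
  have inj: "inj_on g {0..<2 * l}"
  proof (rule inj_onI)
    fix j k assume jk: "j \<in> {0..<2 * l}" "k \<in> {0..<2 * l}" "g j = g k"
    have h: "j div 2 < l" "k div 2 < l" using jk by auto
    have same: "j div 2 = k div 2"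
    proof (rule ccontr)
      assume "j div 2 \<noteq> k div 2"
      then have "m (j div 2) \<noteq> m (k div 2)" using m h by (auto simp: bij_betw_def inj_on_def)
      moreover have "m (j div 2) \<in> M" "m (k div 2) \<in> M" using h bij_betwE[OF m] by auto
      ultimately have "disjnt (m (j div 2)) (m (k div 2))" using disj by (simp add: pairwise_def)
      then show False using gm[of j] gm[of k] jk by (auto simp: disjnt_def)
    qed
    then have "even j = even k" using jk(3) ab[OF h(1)] by (auto simp: g_def split: if_splits)
    then show "j = k" using same by presburger
  qed
  have ga: "g (2 * i) = a i" "g (2 * i + 1) = b i" for i by (simp_all add: g_def)
  have "g ` {0..<2 * l} = \<Union>M"
  proof
    show "g ` {0..<2 * l} \<subseteq> \<Union>M"
    proof
      fix x assume "x \<in> g ` {0..<2 * l}"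
      then obtain k where k: "k < 2 * l" "x = g k" by auto
      then have "m (k div 2) \<in> M" using bij_betwE[OF m] by auto
      then show "x \<in> \<Union>M" using gm[OF k(1)] k by auto
    qed
    show "\<Union>M \<subseteq> g ` {0..<2 * l}"
    proof
      fix x assume "x \<in> \<Union>M"
      then obtain i where i: "i < l" "x \<in> m i" using m by (auto simp: bij_betw_def)
      then have "x = g (2 * i) \<or> x = g (2 * i + 1)" using ab[OF i(1)] ga by auto
      moreover have "2 * i \<in> {0..<2 * l}" "2 * i + 1 \<in> {0..<2 * l}" using i by auto
      ultimately show "x \<in> g ` {0..<2 * l}" by blast
    qed
  qed
  then have bij: "bij_betw g {0..<2 * l} (\<Union>M)" using inj by (simp add: bij_betw_def)
  let ?f = "inv_into {0..<2 * l} g"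
  have f_edge: "?f ` m i = {2 * i, 2 * i + 1}" if i: "i < l" for i
  proof -
    have "?f (g (2 * i)) = 2 * i" "?f (g (2 * i + 1)) = 2 * i + 1"
      using i by (intro inv_into_f_f[OF inj]; simp)+
    then show ?thesis using ab[OF i] by (simp only: ga image_insert image_empty)
  qed
  have "M = m ` {..<l}" using m by (auto simp: bij_betw_def)
  then have "(`) ?f ` M = (\<lambda>i. {2 * i, 2 * i + 1}) ` {..<l}"
    using f_edge by (simp add: image_image)
  then show ?thesis
    unfolding graph_iso_def matching_edges using bij_betw_inv_into[OF bij]
    by (intro exI[of _ ?f]) (simp add: matching_def)
qed

text \<open>A copy of the matching has no isolated vertices, so its edge set determines its vertex
  set. Counting copies is therefore counting sets of disjoint edges.\<close>

lemma count_sub_matching: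
  assumes G: "sgraph G"
  shows "count_sub (matching l) G = mnum l (snd G)"
proof -
  obtain V E where VE: "G = (V, E)" by (cases G)
  note G' = G[unfolded VE]
  note fin = sgraph_finite[OF G']
  have "bij_betw snd {S \<in> subgraphs G. graph_iso S (matching l)} (matchings l E)"
  proof (rule bij_betw_byWitness[where f' = "\<lambda>M. (\<Union>M, M)"])
    show "\<forall>S\<in>{S \<in> subgraphs G. graph_iso S (matching l)}. (\<Union>(snd S), snd S) = S"
    proof
      fix S assume "S \<in> {S \<in> subgraphs G. graph_iso S (matching l)}"
      then show "(\<Union>(snd S), snd S) = S"
        using graph_iso_matching_imp(1)[of "fst S" "snd S" l] by (cases S) (simp add: subgraphs_def)
    qed
    show "snd ` {S \<in> subgraphs G. graph_iso S (matching l)} \<subseteq> matchings l E"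
    proof
      fix M assume "M \<in> snd ` {S \<in> subgraphs G. graph_iso S (matching l)}"
      then obtain U where "(U, M) \<in> subgraphs G" "graph_iso (U, M) (matching l)" by auto
      then show "M \<in> matchings l E"
        using graph_iso_matching_imp(2,3)[of U M l] by (simp add: subgraphs_def matchings_def VE)
    qed
    show "(\<lambda>M. (\<Union>M, M)) ` matchings l E \<subseteq> {S \<in> subgraphs G. graph_iso S (matching l)}"
    proof
      fix S assume "S \<in> (\<lambda>M. (\<Union>M, M)) ` matchings l E"
      then obtain M where M: "M \<subseteq> E" "card M = l" "pairwise disjnt M" "S = (\<Union>M, M)"
        by (auto simp: matchings_def)
      have "\<forall>e\<in>M. card e = 2 \<and> e \<subseteq> V" using M(1) G' by (auto simp: sgraph_def)
      moreover have "finite M" using M(1) fin finite_subset by blast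
      ultimately show "S \<in> {S \<in> subgraphs G. graph_iso S (matching l)}"
        using graph_iso_matchingI[of M l] M by (auto simp: subgraphs_def VE)
    qed
  qed simp
  then show ?thesis
    unfolding count_sub_def mnum_def VE using bij_betw_same_card by fastforce
qed

section \<open>Colourings and copies of F\<close>

lemma proper_colouring_chi:
  assumes "sgraph G" and "chi G \<le> k"
  shows "\<exists>c. proper_colouring G k c"
proof -
  obtain f where "bij_betw f (fst G) {0..<card (fst G)}"
    using assms ex_bij_betw_finite_nat[of "fst G"] by (auto simp: sgraph_def)
  \<comment> \<open>A numbering of the vertices is a proper colouring, so the least number in
    \<open>chi\<close> is attained.\<close>
  then have "proper_colouring G (card (fst G)) f"
    using assms unfolding proper_colouring_def sgraph_def bij_betw_def inj_on_def
    by (auto simp: subset_iff)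
  then have "\<exists>k c. proper_colouring G k c" by blast
  then have "\<exists>c. proper_colouring G (chi G) c" unfolding chi_def by (rule LeastI_ex)
  then show ?thesis using assms(2) unfolding proper_colouring_def by (meson less_le_trans)
qed

lemma chi_le: "proper_colouring G k c \<Longrightarrow> chi G \<le> k"
  unfolding chi_def by (rule Least_le) blast

text \<open>Residues modulo \<open>r\<close> colour the Turan graph properly; a copy of
  \<open>F\<close> would pull this back to a colouring of \<open>F\<close> with too few
  colours.\<close>

lemma not_contains_turan:
  fixes F :: "'a sgraph"
  assumes r: "r > 0" and chi: "r < chi F"
  shows "\<not> contains (turan r n) F"
proof
  assume "contains (turan r n) F"
  then obtain U M where S: "(U, M) \<in> subgraphs (turan r n)" "graph_iso (U, M) F"
    by (auto simp: contains_def)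
  then obtain f where f: "bij_betw f U (fst F)" "snd F = (`) f ` M" by (auto simp: graph_iso_def)
  have inv: "inv_into U f (f x) = x" if "x \<in> U" for x
    using f that by (simp add: bij_betw_def inv_into_f_f)
  define c where "c w = inv_into U f w mod r" for w
  have "proper_colouring F r c"
    unfolding proper_colouring_def
  proof (intro conjI ballI impI)
    show "c v < r" for v using r by (simp add: c_def)
    fix e x y assume e: "e \<in> snd F" "x \<in> e" "y \<in> e" "x \<noteq> y"
    then obtain e0 where e0: "e0 \<in> M" "e = f ` e0" using f by auto
    obtain x0 y0 where xy: "x0 \<in> e0" "y0 \<in> e0" "x = f x0" "y = f y0" using e e0 by auto
    have "e0 \<subseteq> U" "e0 \<in> snd (turan r n)" using S(1) e0 by (auto simp: subgraphs_def)
    then obtain i j where ij: "e0 = {i, j}" "i mod r \<noteq> j mod r" "x0 \<in> U" "y0 \<in> U"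
      using xy by (auto simp: turan_def)
    have "x0 \<noteq> y0" using e xy by auto
    then have "x0 mod r \<noteq> y0 mod r" using ij xy by auto
    then show "c x \<noteq> c y" using ij xy inv by (simp add: c_def)
  qed
  then show False using chi_le chi by (metis not_less)
qed

text \<open>Send \<open>e\<close> to the extra edge and every other colour class of \<open>F\<close>
  without \<open>e\<close> into a part of its own. A part of size \<open>card (fst F)\<close> holds
  any class, and in the part with the extra edge exactly \<open>card (fst F) - 2\<close> places
  remain, enough for the rest of the class of \<open>a\<close> and \<open>b\<close>.\<close>

lemma kplus_contains:
  fixes F :: "'b sgraph" and V :: "'a set"
  assumes G: "sgraph (V, E)" and F: "sgraph F" and e: "e = {a, b}" "e \<in> snd F"
    and c: "proper_colouring (fst F, snd F - {e}) r c" and cab: "c a = c b"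
    and kp: "kplus r (card (fst F)) V E"
  shows "contains (V, E) F"
proof -
  let ?t = "card (fst F)"
  obtain P i u v where i: "i < r" and joined: "joined E P r" and P: "\<forall>j<r. P j \<subseteq> V \<and> card (P j) = ?t"
    and uv: "u \<in> P i" "v \<in> P i" "{u, v} \<in> E"
    using kp unfolding kplus_def by blast
  have finF: "finite (fst F)" and finV: "finite V" using F G by (auto simp: sgraph_def)
  have ab: "a \<in> fst F" "b \<in> fst F" "a \<noteq> b" using sgraph_edge[of "fst F" "snd F" a b] F e by auto
  have uv_ne: "u \<noteq> v" using sgraph_edge[OF G uv(3)] by simp
  have cr: "c x < r" if "x \<in> fst F" for x using c that by (simp add: proper_colouring_def)
  \<comment> \<open>The transposition of \<open>c a\<close> and \<open>i\<close>: it assigns the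
    class containing both ends of \<open>e\<close> to the part containing the extra edge.\<close>
  define s where "s j = (if j = c a then i else if j = i then c a else j)" for j
  have s: "s j < r" if "j < r" for j using that i cr[OF ab(1)] by (auto simp: s_def)
  have s_inj: "s j \<noteq> s k" if "j \<noteq> k" for j k using that by (auto simp: s_def)
  have finP: "finite (P j)" if "j < r" for j using P that finV finite_subset by blast
  have P_disj: "P j \<inter> P k = {}" if "j < r" "k < r" "j \<noteq> k" for j k
  proof -
    have False if "x \<in> P j" "x \<in> P k" for x
    proof -
      have "{x, x} \<in> E" using joined that \<open>j < r\<close> \<open>k < r\<close> \<open>j \<noteq> k\<close> unfolding joined_def by blast
      then show False using sgraph_edge[OF G] by blast
    qed
    then show ?thesis by blast
  qed
  have "\<exists>g. inj_on g (cls (fst F) c j - {a, b}) \<and> g ` (cls (fst F) c j - {a, b}) \<subseteq> P (s j) - {u, v}"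
    if j: "j < r" for j
  proof -
    have "card (cls (fst F) c j - {a, b}) \<le> card (P (s j) - {u, v})"
    proof (cases "j = c a")
      case True
      have "card (cls (fst F) c j - {a, b}) \<le> card (fst F - {a, b})"
        using finF by (intro card_mono) auto
      also have "\<dots> = ?t - card {a, b}" using ab finF by (intro card_Diff_subset) auto
      also have "\<dots> = card (P i) - card {u, v}" using ab uv_ne P i by simp
      also have "\<dots> = card (P (s j) - {u, v})"
        using uv finP[OF i] True by (subst card_Diff_subset) (auto simp: s_def)
      finally show ?thesis .
    next
      case False
      then have "s j \<noteq> i" using s_inj[of j "c a"] by (simp add: s_def)
      then have "P (s j) - {u, v} = P (s j)" using P_disj[OF s[OF j] i] uv by blast
      moreover have "card (cls (fst F) c j - {a, b}) \<le> ?t"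
        using finF by (intro card_mono) auto
      ultimately show ?thesis using P s[OF j] by simp
    qed
    then show ?thesis
      using card_le_inj[of "cls (fst F) c j - {a, b}" "P (s j) - {u, v}"] finF finP[OF s[OF j]] by auto
  qed
  then have "\<forall>j\<in>{..<r}. \<exists>g. inj_on g (cls (fst F) c j - {a, b})
      \<and> g ` (cls (fst F) c j - {a, b}) \<subseteq> P (s j) - {u, v}" by simp
  from bchoice[OF this] obtain g where g': "\<forall>j\<in>{..<r}. inj_on (g j) (cls (fst F) c j - {a, b})
      \<and> g j ` (cls (fst F) c j - {a, b}) \<subseteq> P (s j) - {u, v}" by (rule exE)
  then have g: "inj_on (g j) (cls (fst F) c j - {a, b})"
    "g j ` (cls (fst F) c j - {a, b}) \<subseteq> P (s j) - {u, v}" if "j < r" for j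
    using that by simp_all
  define h where "h x = (if x = a then u else if x = b then v else g (c x) x)" for x
  have g_mem: "g (c x) x \<in> P (s (c x)) - {u, v}" if "x \<in> fst F" "x \<noteq> a" "x \<noteq> b" for x
    using g(2)[OF cr[OF that(1)]] that by blast
  have sca: "s (c a) = i" "s (c b) = i" using cab by (simp_all add: s_def)
  have h_mem: "h x \<in> P (s (c x))" if "x \<in> fst F" for x
    using g_mem[OF that] uv sca by (auto simp: h_def)
  have h_inj: "inj_on h (fst F)"
  proof (rule inj_onI)
    fix x y assume xy: "x \<in> fst F" "y \<in> fst F" "h x = h y"
    have same: "c x = c y"
    proof (rule ccontr)
      assume "c x \<noteq> c y"
      then have "P (s (c x)) \<inter> P (s (c y)) = {}" using P_disj s cr s_inj xy by blast
      then show False using h_mem[OF xy(1)] h_mem[OF xy(2)] xy(3) by auto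
    qed
    show "x = y"
    proof (cases "x \<in> {a, b} \<or> y \<in> {a, b}")
      case True
      then show ?thesis
        using xy g_mem[of x] g_mem[of y] uv_ne by (auto simp: h_def split: if_splits)
    next
      case False
      then have "g (c x) x = g (c x) y" using xy same by (simp add: h_def)
      moreover have "x \<in> cls (fst F) c (c x) - {a, b}" "y \<in> cls (fst F) c (c x) - {a, b}"
        using False xy same by auto
      ultimately show ?thesis using g(1)[OF cr[OF xy(1)]] by (meson inj_onD)
    qed
  qed
  have h_edge: "h ` e' \<in> E" if e': "e' \<in> snd F" for e'
  proof (cases "e' = e")
    case True
    then show ?thesis using uv ab by (simp add: e(1) h_def insert_commute)
  next
    case False
    have "card e' = 2" using F e' by (auto simp: sgraph_def)
    then obtain x y where xy: "e' = {x, y}" "x \<noteq> y" by (auto simp: card_2_iff)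
    have xyF: "x \<in> fst F" "y \<in> fst F" using F e' xy by (auto simp: sgraph_def)
    have "c x \<noteq> c y" using c e' False xy by (auto simp: proper_colouring_def)
    then have "s (c x) \<noteq> s (c y)" by (rule s_inj)
    then have "{h x, h y} \<in> E"
      using joined s cr xyF h_mem unfolding joined_def by blast
    then show ?thesis by (simp add: xy)
  qed
  \<comment> \<open>An isomorphism in \<open>graph_iso\<close> leads from the subgraph to
    \<open>F\<close>, so the inverse of the embedding is the witness.\<close>
  let ?f = "inv_into (fst F) h"
  have f: "?f ` (h ` e') = e'" if "e' \<in> snd F" for e'
  proof -
    have "e' \<subseteq> fst F" using F that by (auto simp: sgraph_def)
    then show ?thesis using h_inj by (simp add: inv_into_image_cancel)
  qed
  have "h ` fst F \<subseteq> V" using h_mem P s cr by blast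
  moreover have "\<forall>e'\<in>snd F. h ` e' \<subseteq> h ` fst F"
    using F by (simp add: sgraph_def image_mono)
  ultimately have sub: "(h ` fst F, (`) h ` snd F) \<in> subgraphs (V, E)"
    using h_edge by (simp add: subgraphs_def image_subset_iff)
  have "bij_betw ?f (h ` fst F) (fst F)"
    by (rule bij_betw_inv_into) (simp add: bij_betw_def h_inj)
  moreover have "snd F = (\<lambda>e'. ?f ` e') ` ((`) h ` snd F)"
    using f by (simp add: image_image)
  ultimately have "graph_iso (h ` fst F, (`) h ` snd F) F"
    unfolding graph_iso_def by (intro exI[of _ ?f]) simp
  then show ?thesis using sub unfolding contains_def by blast
qed

theorem theorem3p8:
  fixes l :: nat and F :: "'a sgraph"
  assumes "l \<ge> 1"
    and "sgraph F"
    and "\<exists>e. color_critical_edge F e"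
    and "\<not> contains (matching l) F"
  shows "\<exists>n0. \<forall>n\<ge>n0. ex_gen n (matching l) F = count_sub (matching l) (turan (chi F - 1) n)"
proof -
  define r where "r = chi F - 1"
  obtain e where e: "e \<in> snd F" "chi (fst F, snd F - {e}) < chi F"
    using assms(3) by (auto simp: color_critical_edge_def)
  \<comment> \<open>The strict inequality for the critical edge makes \<open>chi F\<close> positive,
    so the subtraction in \<open>r\<close> is not truncated.\<close>
  have chi: "chi F = Suc r" using e by (simp add: r_def)
  have card_e: "card e = 2" and eF: "e \<subseteq> fst F" using assms(2) e by (auto simp: sgraph_def)
  obtain a b where ab: "e = {a, b}" "a \<noteq> b" using card_e by (auto simp: card_2_iff)
  have "sgraph (fst F, snd F - {e})" using assms(2) by (simp add: sgraph_def)
  then obtain c where c: "proper_colouring (fst F, snd F - {e}) r c"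
    using proper_colouring_chi[of "(fst F, snd F - {e})" r] e chi by auto
  \<comment> \<open>Otherwise restoring \<open>e\<close> would keep the colouring proper, and
    \<open>F\<close> itself would need only \<open>r\<close> colours.\<close>
  have cab: "c a = c b"
  proof (rule ccontr)
    assume neq: "c a \<noteq> c b"
    have "proper_colouring F r c"
      unfolding proper_colouring_def
    proof (intro conjI ballI impI)
      show "c v < r" if "v \<in> fst F" for v using c that by (simp add: proper_colouring_def)
      show "c x \<noteq> c y" if "e' \<in> snd F" "x \<in> e'" "y \<in> e'" "x \<noteq> y" for e' x y
      proof (cases "e' = e")
        case True
        then show ?thesis using that ab neq by auto
      next
        case False
        then show ?thesis using c that by (simp add: proper_colouring_def)
      qed
    qed
    then show False using chi_le[of F r c] chi by simp
  qed
  have "c a < r" using c eF ab by (simp add: proper_colouring_def)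
  then have r: "r \<ge> 1" by simp
  have finF: "finite (fst F)" using assms(2) by (simp add: sgraph_def)
  have t: "card (fst F) \<ge> 2" using card_mono[OF finF eF] card_e by simp
  obtain n0 where n0: "\<And>(V :: nat set) E. sgraph (V, E) \<Longrightarrow> n0 \<le> card V
      \<Longrightarrow> \<not> kplus r (card (fst F)) V E \<Longrightarrow> mnum l E \<le> tnum r l (card V)"
    using mnum_le_tnum[OF r t, of l, where 'a = nat] by blast
  have sg_turan: "sgraph (turan r n)" for n
    using sgraph_cmult[of "{0..<n}" "\<lambda>i. i mod r"] turan_eq_cmult[of r n] by (simp add: turan_def)
  have "ex_gen n (matching l) F = count_sub (matching l) (turan r n)" if n: "n \<ge> n0" for n
    unfolding ex_gen_def
  proof (rule Max_eqI)
    let ?S = "{count_sub (matching l) G | G :: nat sgraph. sgraph G \<and> fst G = {0..<n} \<and> \<not> contains G F}"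
    \<comment> \<open>There are finitely many graphs on the fixed vertex set, so \<open>Max\<close>
      is a genuine maximum.\<close>
    have "?S \<subseteq> count_sub (matching l) ` ({{0..<n}} \<times> Pow (Pow {0..<n}))"
      by (auto simp: sgraph_def image_iff)
    then show "finite ?S" by (rule finite_subset) simp
    show "count_sub (matching l) (turan r n) \<in> ?S"
      using sg_turan[of n] not_contains_turan[of r F n] r chi by (auto simp: turan_def)
    show "y \<le> count_sub (matching l) (turan r n)" if y: "y \<in> ?S" for y
    proof -
      obtain G where "y = count_sub (matching l) G" "sgraph G" "fst G = {0..<n}" "\<not> contains G F"
        using y by blast
      then obtain V E where G: "y = count_sub (matching l) (V, E)" "sgraph (V, E)" "V = {0..<n}" "\<not> contains (V, E) F"
        by (cases G) simp
      have "\<not> kplus r (card (fst F)) V E"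
        using kplus_contains[OF G(2) assms(2) ab(1) e(1) c cab] G(4) by blast
      then have "mnum l E \<le> tnum r l (card V)" using n0[OF G(2)] G(3) n by simp
      then show ?thesis
        using G by (simp add: count_sub_matching sg_turan tnum_def)
    qed
  qed
  then show ?thesis unfolding r_def by blast
qed

end
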